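(* Let $\phi(x,y)$ be an $L$-formula, $M$ an $L$-structure, $A$ a set of $l(x)$-tuples from $M$, and $M^{*}$ an $|M|^{+}$-saturated elementary extension of $M$. (a) The following are equivalent: (i) $\phi(x,y)$ has $NIP$ in $A$. (ii) For any sequence $(a_{i}:i<\omega)$ of elements of $A$ there is a subsequence $(a_{j_{i}}:i<\omega)$ such that for every $b\in M^{*}$ there is an eventual truth value (in $M^*$) of $(\phi(a_{j_{i}},b):i<\omega)$. (b) Moreover, if $A$ is countable, then each of the following is also equivalent to (i) and (ii): (iii) Every $p(x)\in S_{\phi}(M^{*})$ which is finitely satisfiable in $A$ is Borel definable over $A$, namely $\{q\in S_{\phi^{opp}}(A): \phi(x,b)\in p \text{ for some/any } b\in M^{*} \text{ realizing } q\}$ is a Borel subset of $S_{\phi^{opp}}(A)$. (iv) For every $p(x)\in S_{\phi}(M^{*})$ which is finitely satisfiable in $A$, there is a sequence $(a_{i}:i<\omega)$ from $A$ such that for every $b\in M^{*}$, $\phi(p,b)$ is the eventual truth value of $(\phi(a_{i},b):i<\omega)$. (v) The number of $p(x)\in S_{\phi}(M^{*})$ which are finitely satisfiable in $A$ is $<2^{2^{\omega}}$ (in fact, in this case it is $\leq 2^{\omega}$).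
   Context: Here $x,y$ are finite tuples of variables, $l(x)$ is the length of $x$, and "$b\in M^*$" means that $b$ is a tuple from $M^*$ of the appropriate length, here $l(y)$. A set $\{a_{\alpha}:\alpha<\kappa\}$ of $l(x)$-tuples from $M$ is an $IP$-witness for $\phi(x,y)$ if for all finite disjoint subsets $I,J$ of $\kappa$, $M\models \exists y(\bigwedge_{\alpha\in I}\phi(a_{\alpha},y)\wedge\bigwedge_{\beta\in J}\neg\phi(a_{\beta},y))$. The formula $\phi(x,y)$ has $IP$ in $A$ if there is a countably infinite sequence $(a_{i}:i<\omega)$ of elements of $A$ which is an $IP$-witness for $\phi(x,y)$; $\phi(x,y)$ has $NIP$ in $A$ if it does not have $IP$ in $A$. $\phi^{opp}(y,x)$ is the formula $\phi(x,y)$ with the roles of the variables exchanged. $S_{\phi^{opp}}(A)$ is the (compact, Stone) space of ultrafilters on the Boolean algebra generated by the formulas $\phi(a,y)$ (equivalently, the definable sets $\phi(a,y)(M)$) for $a\in A$. $S_{\phi}(M^{*})$ is the space of ultrafilters on the Boolean algebra of formulas (definable sets) generated by the $\phi(x,b)$ for $b\in M^{*}$. For $p\in S_\phi(M^* )$ and $b\in M^*$, $\phi(p,b)$ denotes the truth value of "$\phi(x,b)\in p$". A type $p(x)\in S_{\phi}(M^{*})$ is finitely satisfiable in $A$ if whenever $\chi(x)\in p$ there is $a\in A$ with $M^{*}\models\chi(a)$. If $p$ is finitely satisfiable in $A$, then $\phi(p,b)$ depends only on the type $tp_{\phi^{opp}}(b/A)\in S_{\phi^{opp}}(A)$, which is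 why "some/any" makes sense in (iii). A sequence of truth values has an eventual truth value if it is eventually constant, the eventual truth value being that constant. *)

theory Defs
  imports "HOL-Analysis.Analysis"
begin

unbundle cardinal_syntax

section \<open>First-order logic\<close>

text \<open>A symbol belongs to the language iff its arity is defined; thus a language may lack function
  symbols (or relation symbols) altogether, although HOL types are never empty.\<close>

record ('f, 'r) lang =
  fun_ar :: "'f \<rightharpoonup> nat"
  rel_ar :: "'r \<rightharpoonup> nat"

datatype 'f trm = Var nat | Fn 'f "'f trm list"

datatype ('f, 'r) fm =
    Eq "'f trm" "'f trm"
  | Rel 'r "'f trm list"
  | Neg "('f, 'r) fm"
  | Conj "('f, 'r) fm" "('f, 'r) fm"
  | Ex nat "('f, 'r) fm"

fun wf_trm :: "('f, 'r) lang \<Rightarrow> 'f trm \<Rightarrow> bool" where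
  "wf_trm L (Var v) \<longleftrightarrow> True"
| "wf_trm L (Fn f ts) \<longleftrightarrow> fun_ar L f = Some (length ts) \<and> (\<forall>t \<in> set ts. wf_trm L t)"

fun wf_fm :: "('f, 'r) lang \<Rightarrow> ('f, 'r) fm \<Rightarrow> bool" where
  "wf_fm L (Eq s t) \<longleftrightarrow> wf_trm L s \<and> wf_trm L t"
| "wf_fm L (Rel r ts) \<longleftrightarrow> rel_ar L r = Some (length ts) \<and> (\<forall>t \<in> set ts. wf_trm L t)"
| "wf_fm L (Neg \<phi>) \<longleftrightarrow> wf_fm L \<phi>"
| "wf_fm L (Conj \<phi> \<psi>) \<longleftrightarrow> wf_fm L \<phi> \<and> wf_fm L \<psi>"
| "wf_fm L (Ex v \<phi>) \<longleftrightarrow> wf_fm L \<phi>"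

fun fv_trm :: "'f trm \<Rightarrow> nat set" where
  "fv_trm (Var v) = {v}"
| "fv_trm (Fn f ts) = (\<Union>t \<in> set ts. fv_trm t)"

fun fv :: "('f, 'r) fm \<Rightarrow> nat set" where
  "fv (Eq s t) = fv_trm s \<union> fv_trm t"
| "fv (Rel r ts) = (\<Union>t \<in> set ts. fv_trm t)"
| "fv (Neg \<phi>) = fv \<phi>"
| "fv (Conj \<phi> \<psi>) = fv \<phi> \<union> fv \<psi>"
| "fv (Ex v \<phi>) = fv \<phi> - {v}"

record ('f, 'r, 'm) struc =
  univ :: "'m set"
  fint :: "'f \<Rightarrow> 'm list \<Rightarrow> 'm"
  rint :: "'r \<Rightarrow> 'm list \<Rightarrow> bool"

definition is_struc :: "('f, 'r) lang \<Rightarrow> ('f, 'r, 'm) struc \<Rightarrow> bool" where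
  "is_struc L M \<longleftrightarrow> univ M \<noteq> {} \<and>
     (\<forall>f ms. fun_ar L f = Some (length ms) \<and> set ms \<subseteq> univ M \<longrightarrow> fint M f ms \<in> univ M)"

fun eval_trm :: "('f, 'r, 'm) struc \<Rightarrow> (nat \<Rightarrow> 'm) \<Rightarrow> 'f trm \<Rightarrow> 'm" where
  "eval_trm M e (Var v) = e v"
| "eval_trm M e (Fn f ts) = fint M f (map (eval_trm M e) ts)"

fun sat :: "('f, 'r, 'm) struc \<Rightarrow> (nat \<Rightarrow> 'm) \<Rightarrow> ('f, 'r) fm \<Rightarrow> bool" where
  "sat M e (Eq s t) \<longleftrightarrow> eval_trm M e s = eval_trm M e t"
| "sat M e (Rel r ts) \<longleftrightarrow> rint M r (map (eval_trm M e) ts)"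
| "sat M e (Neg \<phi>) \<longleftrightarrow> \<not> sat M e \<phi>"
| "sat M e (Conj \<phi> \<psi>) \<longleftrightarrow> sat M e \<phi> \<and> sat M e \<psi>"
| "sat M e (Ex v \<phi>) \<longleftrightarrow> (\<exists>m \<in> univ M. sat M (e(v := m)) \<phi>)"

definition tuples :: "('f, 'r, 'm) struc \<Rightarrow> nat \<Rightarrow> 'm list set" where
  "tuples M n = {c. length c = n \<and> set c \<subseteq> univ M}"

definition upd :: "(nat \<Rightarrow> 'm) \<Rightarrow> nat list \<Rightarrow> 'm list \<Rightarrow> nat \<Rightarrow> 'm" where
  "upd e vs c = (\<lambda>v. case map_of (zip vs c) v of Some m \<Rightarrow> m | None \<Rightarrow> e v)"

text \<open>The extension is literal, \<open>univ M \<subseteq> univ N\<close>. Applied to atomic formulas, the second clause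
  says that \<open>M\<close> is a substructure of \<open>N\<close>.\<close>

definition elem_ext :: "('f, 'r) lang \<Rightarrow> ('f, 'r, 'm) struc \<Rightarrow> ('f, 'r, 'm) struc \<Rightarrow> bool" where
  "elem_ext L M N \<longleftrightarrow> is_struc L M \<and> is_struc L N \<and> univ M \<subseteq> univ N \<and>
     (\<forall>\<psi> e. wf_fm L \<psi> \<and> e ` fv \<psi> \<subseteq> univ M \<longrightarrow> (sat M e \<psi> \<longleftrightarrow> sat N e \<psi>))"

text \<open>\<open>\<kappa>\<close>-saturation: a set of formulas in a finite tuple \<open>zs\<close> of variables, with parameters from
  a set of fewer than \<open>\<kappa>\<close> elements, is realized if it is finitely satisfiable. A formula with
  parameters in \<open>B\<close> is a pair \<open>(\<psi>, e)\<close> where \<open>e\<close> supplies the parameters for the free variables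
  outside \<open>zs\<close>.\<close>

definition saturated :: "('f, 'r) lang \<Rightarrow> 'k rel \<Rightarrow> ('f, 'r, 'm) struc \<Rightarrow> bool" where
  "saturated L \<kappa> N \<longleftrightarrow>
     (\<forall>B zs \<Gamma>. B \<subseteq> univ N \<and> |B| <o \<kappa> \<and> distinct zs \<and>
        (\<forall>(\<psi>, e) \<in> \<Gamma>. wf_fm L \<psi> \<and> e ` (fv \<psi> - set zs) \<subseteq> B) \<and>
        (\<forall>\<Delta>. finite \<Delta> \<and> \<Delta> \<subseteq> \<Gamma> \<longrightarrow>
           (\<exists>c \<in> tuples N (length zs). \<forall>(\<psi>, e) \<in> \<Delta>. sat N (upd e zs c) \<psi>)) \<longrightarrow>
        (\<exists>c \<in> tuples N (length zs). \<forall>(\<psi>, e) \<in> \<Gamma>. sat N (upd e zs c) \<psi>))"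

section \<open>The independence property in a set of tuples\<close>

text \<open>A partitioned formula \<open>\<phi>(x, y)\<close> is a formula \<open>\<phi>\<close> together with two lists \<open>xs\<close>, \<open>ys\<close> of
  variables. The base assignment \<open>\<lambda>_. undefined\<close> is irrelevant, because in the theorem all free
  variables of \<open>\<phi>\<close> occur in \<open>xs @ ys\<close>.\<close>

definition holds ::
  "('f, 'r, 'm) struc \<Rightarrow> ('f, 'r) fm \<Rightarrow> nat list \<Rightarrow> nat list \<Rightarrow> 'm list \<Rightarrow> 'm list \<Rightarrow> bool" where
  "holds M \<phi> xs ys a b \<longleftrightarrow> sat M (upd (\<lambda>_. undefined) (xs @ ys) (a @ b)) \<phi>"

definition ip_witness ::
  "('f, 'r, 'm) struc \<Rightarrow> ('f, 'r) fm \<Rightarrow> nat list \<Rightarrow> nat list \<Rightarrow> 'i set \<Rightarrow> ('i \<Rightarrow> 'm list) \<Rightarrow> bool" where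
  "ip_witness M \<phi> xs ys K a \<longleftrightarrow>
     (\<forall>I J. finite I \<and> finite J \<and> I \<subseteq> K \<and> J \<subseteq> K \<and> I \<inter> J = {} \<longrightarrow>
        (\<exists>b \<in> tuples M (length ys).
           (\<forall>i \<in> I. holds M \<phi> xs ys (a i) b) \<and> (\<forall>j \<in> J. \<not> holds M \<phi> xs ys (a j) b)))"

definition IP_in ::
  "('f, 'r, 'm) struc \<Rightarrow> ('f, 'r) fm \<Rightarrow> nat list \<Rightarrow> nat list \<Rightarrow> 'm list set \<Rightarrow> bool" where
  "IP_in M \<phi> xs ys A \<longleftrightarrow> (\<exists>a :: nat \<Rightarrow> 'm list. range a \<subseteq> A \<and> ip_witness M \<phi> xs ys UNIV a)"

definition NIP_in ::
  "('f, 'r, 'm) struc \<Rightarrow> ('f, 'r) fm \<Rightarrow> nat list \<Rightarrow> nat list \<Rightarrow> 'm list set \<Rightarrow> bool" where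
  "NIP_in M \<phi> xs ys A \<longleftrightarrow> \<not> IP_in M \<phi> xs ys A"

definition eventual_truth_value :: "(nat \<Rightarrow> bool) \<Rightarrow> bool \<Rightarrow> bool" where
  "eventual_truth_value s t \<longleftrightarrow> (\<forall>\<^sub>F i in sequentially. s i = t)"

section \<open>Local types\<close>

definition is_ultrafilter :: "'a set \<Rightarrow> 'a set set \<Rightarrow> 'a set set \<Rightarrow> bool" where
  "is_ultrafilter \<Omega> \<B> U \<longleftrightarrow> U \<subseteq> \<B> \<and> \<Omega> \<in> U \<and> {} \<notin> U \<and>
     (\<forall>X \<in> U. \<forall>Y \<in> U. X \<inter> Y \<in> U) \<and>
     (\<forall>X \<in> U. \<forall>Y \<in> \<B>. X \<subseteq> Y \<longrightarrow> Y \<in> U) \<and>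
     (\<forall>X \<in> \<B>. X \<in> U \<or> \<Omega> - X \<in> U)"

definition stone_topology :: "'a set \<Rightarrow> 'a set set \<Rightarrow> 'a set set topology" where
  "stone_topology \<Omega> \<B> = topology_generated_by {{U. is_ultrafilter \<Omega> \<B> U \<and> X \<in> U} | X. X \<in> \<B>}"

definition borel_sets_of :: "'a topology \<Rightarrow> 'a set set" where
  "borel_sets_of T = sigma_sets (topspace T) {U. openin T U}"

text \<open>Formulas are identified with the sets they define. The following three notions treat
  \<open>zs\<close> as the object variables and \<open>ws\<close> as the parameter variables of \<open>\<phi>\<close>: the pair
  \<open>(zs, ws) = (xs, ys)\<close> gives \<open>\<phi>\<close>, and \<open>(ys, xs)\<close> gives \<open>\<phi>\<^sup>o\<^sup>p\<^sup>p\<close>.\<close>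

definition inst ::
  "('f, 'r, 'm) struc \<Rightarrow> ('f, 'r) fm \<Rightarrow> nat list \<Rightarrow> nat list \<Rightarrow> 'm list \<Rightarrow> 'm list set" where
  "inst M \<phi> zs ws c = {d \<in> tuples M (length zs). holds M \<phi> zs ws d c}"

definition inst_algebra ::
  "('f, 'r, 'm) struc \<Rightarrow> ('f, 'r) fm \<Rightarrow> nat list \<Rightarrow> nat list \<Rightarrow> 'm list set \<Rightarrow> 'm list set set" where
  "inst_algebra M \<phi> zs ws C = algebra (tuples M (length zs)) hull (inst M \<phi> zs ws ` C)"

definition types ::
  "('f, 'r, 'm) struc \<Rightarrow> ('f, 'r) fm \<Rightarrow> nat list \<Rightarrow> nat list \<Rightarrow> 'm list set \<Rightarrow> 'm list set set set" where
  "types M \<phi> zs ws C =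
     {U. is_ultrafilter (tuples M (length zs)) (inst_algebra M \<phi> zs ws C) U}"

definition types_topology ::
  "('f, 'r, 'm) struc \<Rightarrow> ('f, 'r) fm \<Rightarrow> nat list \<Rightarrow> nat list \<Rightarrow> 'm list set \<Rightarrow> 'm list set set topology" where
  "types_topology M \<phi> zs ws C =
     stone_topology (tuples M (length zs)) (inst_algebra M \<phi> zs ws C)"

text \<open>\<open>S\<^sub>\<phi>(N)\<close>, the set of \<open>p \<in> S\<^sub>\<phi>(N)\<close> finitely satisfiable in \<open>A\<close>, and \<open>S\<^sub>\<phi>\<^sub>o\<^sub>p\<^sub>p(A)\<close> computed in \<open>M\<close>.\<close>

definition S_phi ::
  "('f, 'r, 'm) struc \<Rightarrow> ('f, 'r) fm \<Rightarrow> nat list \<Rightarrow> nat list \<Rightarrow> 'm list set set set" where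
  "S_phi N \<phi> xs ys = types N \<phi> xs ys (tuples N (length ys))"

definition fin_sat_types ::
  "('f, 'r, 'm) struc \<Rightarrow> ('f, 'r) fm \<Rightarrow> nat list \<Rightarrow> nat list \<Rightarrow> 'm list set \<Rightarrow> 'm list set set set" where
  "fin_sat_types N \<phi> xs ys A = {p \<in> S_phi N \<phi> xs ys. \<forall>X \<in> p. \<exists>a \<in> A. a \<in> X}"

definition S_opp ::
  "('f, 'r, 'm) struc \<Rightarrow> ('f, 'r) fm \<Rightarrow> nat list \<Rightarrow> nat list \<Rightarrow> 'm list set \<Rightarrow> 'm list set set set" where
  "S_opp M \<phi> xs ys A = types M \<phi> ys xs A"

text \<open>\<open>\<phi>(p, b)\<close>, i.e. whether \<open>\<phi>(x, b) \<in> p\<close>.\<close>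

definition phi_at ::
  "('f, 'r, 'm) struc \<Rightarrow> ('f, 'r) fm \<Rightarrow> nat list \<Rightarrow> nat list \<Rightarrow> 'm list set set \<Rightarrow> 'm list \<Rightarrow> bool" where
  "phi_at N \<phi> xs ys p b \<longleftrightarrow> inst N \<phi> xs ys b \<in> p"

text \<open>\<open>tp(b/A)\<close> for \<open>b\<close> in the elementary extension \<open>N\<close> of \<open>M\<close>: the sets \<open>\<psi>(M)\<close>, where \<open>\<psi>\<close> is a
  Boolean combination of formulas \<open>\<phi>(a, y)\<close>, \<open>a \<in> A\<close>, that holds of \<open>b\<close> in \<open>N\<close>. By elementarity
  \<open>\<psi>(M)\<close> is the trace on \<open>M\<close> of \<open>\<psi>(N)\<close>.\<close>

definition tp_opp ::
  "('f, 'r, 'm) struc \<Rightarrow> ('f, 'r, 'm) struc \<Rightarrow> ('f, 'r) fm \<Rightarrow> nat list \<Rightarrow> nat list \<Rightarrow> 'm list set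
     \<Rightarrow> 'm list \<Rightarrow> 'm list set set" where
  "tp_opp M N \<phi> xs ys A b =
     (\<lambda>X. X \<inter> tuples M (length ys)) ` {X \<in> inst_algebra N \<phi> ys xs A. b \<in> X}"

text \<open>For \<open>p\<close> finitely satisfiable in \<open>A\<close>, the existential quantifier over realizations \<open>b\<close> of \<open>q\<close>
  may equivalently be replaced by a universal one.\<close>

definition borel_definable ::
  "('f, 'r, 'm) struc \<Rightarrow> ('f, 'r, 'm) struc \<Rightarrow> ('f, 'r) fm \<Rightarrow> nat list \<Rightarrow> nat list \<Rightarrow> 'm list set
     \<Rightarrow> 'm list set set \<Rightarrow> bool" where
  "borel_definable M N \<phi> xs ys A p \<longleftrightarrow>
     {q \<in> S_opp M \<phi> xs ys A. \<exists>b \<in> tuples N (length ys).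
        tp_opp M N \<phi> xs ys A b = q \<and> phi_at N \<phi> xs ys p b}
     \<in> borel_sets_of (types_topology M \<phi> ys xs A)"

end

theory Submission
  imports Defs
begin

text \<open>Write \<open>N\<close> for the saturated extension and \<open>R a b\<close> for the truth of \<open>\<phi>(a, b)\<close> in \<open>N\<close>. The model theory enters
only through two facts. By elementarity, a pattern of truth values of finitely many \<open>\<phi>(a, y)\<close> with
\<open>a\<close> in \<open>M\<close> is realized in \<open>N\<close> iff it is realized in \<open>M\<close> (\<open>pattern_in_M\<close>); by saturation, a pattern on a
whole set of such \<open>a\<close> is realized in \<open>N\<close> as soon as its finite parts are (\<open>pattern_realized\<close>). Also, for
an enumeration \<open>a\<close> of \<open>A\<close>, a type \<open>p\<close> finitely satisfiable in \<open>A\<close> is the limit of \<open>a\<close> along some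
ultrafilter \<open>U\<close> on the indices, that is, \<open>\<phi>(p, b)\<close> holds iff \<open>{i. R (a i) b} \<in> U\<close>, and every ultrafilter
arises from such a type.

NIP implies the other conditions. Fix a countable set of indices with an ultrafilter \<open>U\<close>. Call a set \<open>D\<close>
of parameters \<^emph>\<open>settled\<close> if there are \<open>X 0, X 1, \<dots> \<in> U\<close> such that for every \<open>b \<in> D\<close> the truth value of
\<open>R (a i) b\<close> is constant on one of the \<open>X k\<close>. Settled sets are closed under countable unions. If \<open>D\<close>
is not settled, then for \<open>U\<close>-almost every \<open>i\<close> neither \<open>{b \<in> D. R (a i) b}\<close> nor \<open>{b \<in> D. \<not> R (a i) b}\<close>
is settled: if, say, the first were settled for all \<open>i\<close> in a set \<open>X \<in> U\<close>, then \<open>D\<close> would be the union of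
these countably many sets and of a subset of \<open>{b. \<forall>i\<in>X. \<not> R (a i) b}\<close>, which \<open>X\<close> alone settles. So an
unsettled set can be halved again and again, which produces an independent sequence and thus IP
(\<open>unsettled_imp_independent\<close>). Under NIP all parameters are therefore settled by one sequence \<open>X\<close>.
Any indices \<open>j m \<in> (\<Inter>k\<le>m. X k)\<close> then give a sequence \<open>a \<circ> j\<close> whose truth values converge, at every
\<open>b\<close>, to the limit along \<open>U\<close>. With a free \<open>U\<close> the indices can be chosen increasing, which gives a
convergent subsequence; with the \<open>U\<close> of a type, the type is the limit of a sequence from \<open>A\<close>.
Moreover \<open>\<phi>(p, b)\<close> holds iff \<open>R (a i) b\<close> for all \<open>i\<close> in some \<open>X k\<close>, so the definition of \<open>p\<close> is a
countable union of closed sets, in particular Borel. This argument takes the place of the theorem of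
Bourgain, Fremlin and Talagrand on pointwise compact sets of functions of the first Baire class.

IP refutes the other conditions. If \<open>a\<close> witnesses IP, then for every set \<open>S\<close> of indices some \<open>b\<close>
satisfies \<open>R (a i) b \<longleftrightarrow> i \<in> S\<close> (\<open>IP_all_patterns\<close>). Letting \<open>S\<close> alternate along a given subsequence
shows that this subsequence diverges at some \<open>b\<close>. There are \<open>2\<^sup>\<omega>\<close> independent subsets of a countable set, hence \<open>2\<close> to the \<open>2\<^sup>\<omega>\<close> ultrafilters
that these sets tell apart, and at least as many types (\<open>IP_many_types\<close>). If on the
other hand \<open>A\<close> is countable and all types are Borel definable, or all are limits of sequences from \<open>A\<close>,
then there are at most \<open>2\<^sup>\<omega>\<close> types: a type is determined by its definition, a Borel set of a second
countable space, and also by any sequence that converges to it.\<close>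

section \<open>Ultrafilters\<close>

lemma is_ultrafilter_UNIV_iff:
  "is_ultrafilter UNIV UNIV U \<longleftrightarrow>
     UNIV \<in> U \<and> {} \<notin> U \<and> (\<forall>X\<in>U. \<forall>Y\<in>U. X \<inter> Y \<in> U) \<and> (\<forall>X\<in>U. \<forall>Y. X \<subseteq> Y \<longrightarrow> Y \<in> U) \<and>
     (\<forall>X. X \<in> U \<or> - X \<in> U)"
  by (simp add: is_ultrafilter_def Compl_eq_Diff_UNIV)

lemma
  assumes "is_ultrafilter UNIV UNIV U"
  shows ultrafilter_UNIV: "UNIV \<in> U"
    and ultrafilter_Int: "X \<in> U \<Longrightarrow> Y \<in> U \<Longrightarrow> X \<inter> Y \<in> U"
    and ultrafilter_mono: "X \<in> U \<Longrightarrow> X \<subseteq> Y \<Longrightarrow> Y \<in> U"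
    and ultrafilter_nonempty: "X \<in> U \<Longrightarrow> X \<noteq> {}"
  using assms unfolding is_ultrafilter_UNIV_iff by auto

lemma ultrafilter_finite_INT:
  assumes "is_ultrafilter UNIV UNIV U" "finite I" "\<And>i. i \<in> I \<Longrightarrow> X i \<in> U"
  shows "(\<Inter>i\<in>I. X i) \<in> U"
  using assms(2,3)
proof (induction I)
  case empty
  then show ?case
    using assms(1) by (simp add: is_ultrafilter_UNIV_iff)
next
  case (insert i I)
  then show ?case
    using assms(1) by (simp add: is_ultrafilter_UNIV_iff)
qed

lemma ultrafilter_Compl_iff:
  assumes "is_ultrafilter UNIV UNIV U"
  shows "- X \<in> U \<longleftrightarrow> X \<notin> U"
  using assms unfolding is_ultrafilter_UNIV_iff
  by (metis Compl_disjoint)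

text \<open>The ultrafilter is a maximal family with the finite intersection property.\<close>

lemma ultrafilter_exists:
  assumes fip: "\<And>\<F>. finite \<F> \<Longrightarrow> \<F> \<subseteq> \<S> \<Longrightarrow> \<Inter>\<F> \<noteq> {}"
  shows "\<exists>U. is_ultrafilter UNIV UNIV U \<and> \<S> \<subseteq> U"
proof -
  define Fip where "Fip = {\<T>. \<S> \<subseteq> \<T> \<and> (\<forall>\<F>. finite \<F> \<and> \<F> \<subseteq> \<T> \<longrightarrow> \<Inter>\<F> \<noteq> {})}"
  have "\<exists>U\<in>Fip. \<forall>\<T>\<in>Fip. U \<subseteq> \<T> \<longrightarrow> \<T> = U"
  proof (rule subset_Zorn_nonempty)
    show "Fip \<noteq> {}"
      using fip by (auto simp: Fip_def)
    fix \<C> assume \<C>: "\<C> \<noteq> {}" "subset.chain Fip \<C>"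
    have "\<Inter>\<F> \<noteq> {}" if "finite \<F>" "\<F> \<subseteq> \<Union>\<C>" for \<F>
    proof -
      from finite_subset_Union_chain[OF that \<C>] obtain \<T> where "\<T> \<in> \<C>" "\<F> \<subseteq> \<T>"
        by blast
      then show ?thesis
        using \<C>(2) \<open>finite \<F>\<close> by (auto simp: Fip_def subset.chain_def)
    qed
    moreover have "\<S> \<subseteq> \<Union>\<C>"
    proof -
      from \<C>(1) obtain \<T> where \<T>: "\<T> \<in> \<C>"
        by blast
      with \<C>(2) have "\<T> \<in> Fip"
        unfolding subset.chain_def by blast
      with \<T> show ?thesis
        unfolding Fip_def by blast
    qed
    ultimately show "\<Union>\<C> \<in> Fip"
      by (simp add: Fip_def)
  qed
  then obtain U where U: "U \<in> Fip" and max: "\<And>\<T>. \<T> \<in> Fip \<Longrightarrow> U \<subseteq> \<T> \<Longrightarrow> \<T> = U"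
    by blast
  have fipU: "\<Inter>\<F> \<noteq> {}" if "finite \<F>" "\<F> \<subseteq> U" for \<F>
    using U that by (auto simp: Fip_def)
  have mem: "X \<in> U" if "\<And>\<F>. finite \<F> \<Longrightarrow> \<F> \<subseteq> U \<Longrightarrow> X \<inter> \<Inter>\<F> \<noteq> {}" for X
  proof -
    have "\<Inter>\<F> \<noteq> {}" if \<F>: "finite \<F>" "\<F> \<subseteq> insert X U" for \<F>
    proof -
      have "X \<inter> \<Inter>(\<F> - {X}) \<noteq> {}"
        using \<F> by (intro \<open>\<And>\<F>. finite \<F> \<Longrightarrow> \<F> \<subseteq> U \<Longrightarrow> X \<inter> \<Inter>\<F> \<noteq> {}\<close>) auto
      then show ?thesis
        by auto
    qed
    then have "insert X U \<in> Fip"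
      using U by (auto simp: Fip_def)
    then show ?thesis
      using max[of "insert X U"] by blast
  qed
  have inter: "X \<inter> Y \<in> U" if "X \<in> U" "Y \<in> U" for X Y
  proof (rule mem)
    fix \<F> assume "finite \<F>" "\<F> \<subseteq> U"
    then show "X \<inter> Y \<inter> \<Inter>\<F> \<noteq> {}"
      using fipU[of "insert X (insert Y \<F>)"] that by (simp add: Int_assoc)
  qed
  have up: "Y \<in> U" if "X \<in> U" "X \<subseteq> Y" for X Y
  proof (rule mem)
    fix \<F> assume "finite \<F>" "\<F> \<subseteq> U"
    then show "Y \<inter> \<Inter>\<F> \<noteq> {}"
      using fipU[of "insert X \<F>"] that by auto
  qed
  have dich: "X \<in> U \<or> - X \<in> U" for X
  proof (rule ccontr)
    assume neg: "\<not> (X \<in> U \<or> - X \<in> U)"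
    obtain \<F> \<G> where "finite \<F>" "\<F> \<subseteq> U" "X \<inter> \<Inter>\<F> = {}" "finite \<G>" "\<G> \<subseteq> U" "- X \<inter> \<Inter>\<G> = {}"
      using mem[of X] mem[of "- X"] neg by meson
    moreover have "\<Inter>(\<F> \<union> \<G>) \<subseteq> (X \<inter> \<Inter>\<F>) \<union> (- X \<inter> \<Inter>\<G>)"
      by blast
    ultimately have "\<Inter>(\<F> \<union> \<G>) = {}" "finite (\<F> \<union> \<G>)" "\<F> \<union> \<G> \<subseteq> U"
      by auto
    then show False
      using fipU by blast
  qed
  have "UNIV \<in> U"
    by (rule mem) (simp add: fipU)
  moreover have "{} \<notin> U"
    using fipU[of "{{}}"] by auto
  ultimately have "is_ultrafilter UNIV UNIV U"
    unfolding is_ultrafilter_UNIV_iff using inter up dich by blast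
  then show ?thesis
    using U by (auto simp: Fip_def)
qed

lemma free_ultrafilter_exists:
  "\<exists>U :: nat set set. is_ultrafilter UNIV UNIV U \<and> (\<forall>k. {k..} \<in> U)"
proof -
  have "\<exists>U :: nat set set. is_ultrafilter UNIV UNIV U \<and> range atLeast \<subseteq> U"
  proof (rule ultrafilter_exists)
    fix \<F> :: "nat set set" assume \<F>: "finite \<F>" "\<F> \<subseteq> range atLeast"
    obtain F where F: "finite F" "\<F> = atLeast ` F"
      using finite_subset_image[OF \<F>] by blast
    have "Max (insert 0 F) \<in> \<Inter>\<F>"
      using F by auto
    then show "\<Inter>\<F> \<noteq> {}"
      by blast
  qed
  then show ?thesis
    by blast
qed

section \<open>Settled sets and independent sequences\<close>

text \<open>The \<open>U\<close>-limit of \<open>R i b\<close> is visible on one of countably many members of \<open>U\<close>, for all \<open>b \<in> D\<close> at once.\<close>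

definition settled :: "'i set set \<Rightarrow> ('i \<Rightarrow> 'b \<Rightarrow> bool) \<Rightarrow> 'b set \<Rightarrow> bool" where
  "settled U R D \<longleftrightarrow>
     (\<exists>X :: nat \<Rightarrow> 'i set. (\<forall>k. X k \<in> U) \<and> (\<forall>b\<in>D. \<exists>k. \<exists>t. \<forall>i\<in>X k. R i b = t))"

lemma settled_subset: "settled U R D \<Longrightarrow> D' \<subseteq> D \<Longrightarrow> settled U R D'"
  unfolding settled_def by blast

lemma settled_empty: "is_ultrafilter UNIV UNIV U \<Longrightarrow> settled U R {}"
  unfolding settled_def by (rule exI[of _ "\<lambda>_. UNIV"]) (simp add: is_ultrafilter_UNIV_iff)

lemma settled_homogeneous: "X \<in> U \<Longrightarrow> settled U R {b. \<forall>i\<in>X. R i b = t}"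
  unfolding settled_def by (rule exI[of _ "\<lambda>_. X"]) blast

lemma settled_UN_nat:
  fixes R :: "'i \<Rightarrow> 'b \<Rightarrow> bool" and D :: "nat \<Rightarrow> 'b set"
  assumes "\<And>m. settled U R (D m)"
  shows "settled U R (\<Union>m. D m)"
proof -
  have ex: "\<forall>m. \<exists>X :: nat \<Rightarrow> 'i set. (\<forall>k. X k \<in> U) \<and> (\<forall>b\<in>D m. \<exists>k. \<exists>t. \<forall>i\<in>X k. R i b = t)"
    using assms by (simp add: settled_def)
  obtain X :: "nat \<Rightarrow> nat \<Rightarrow> 'i set"
    where X: "\<forall>m. (\<forall>k. X m k \<in> U) \<and> (\<forall>b\<in>D m. \<exists>k. \<exists>t. \<forall>i\<in>X m k. R i b = t)"
    by (rule exE[OF choice[OF ex]]) (rule that)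
  define Z where "Z k = case_prod X (prod_decode k)" for k
  have Z: "Z (prod_encode (m, k)) = X m k" for m k
    by (simp add: Z_def)
  have "\<forall>k. Z k \<in> U"
    using X by (simp add: Z_def split: prod.split)
  moreover have "\<exists>k. \<exists>t. \<forall>i\<in>Z k. R i b = t" if b: "b \<in> D m" for b m
  proof -
    from X b obtain k t where "\<forall>i\<in>X m k. R i b = t"
      by presburger
    then have "\<forall>i\<in>Z (prod_encode (m, k)). R i b = t"
      by (simp only: Z)
    then show ?thesis
      by (intro exI)
  qed
  ultimately show ?thesis
    unfolding settled_def by (intro exI[of _ Z]) simp
qed

text \<open>The heart of the matter. If almost all halves \<open>{b \<in> D. R i b = t}\<close> were settled, say those for
\<open>i \<in> X \<in> U\<close>, then they would cover \<open>D\<close> up to points at which \<open>R i b\<close> is constantly \<open>\<not> t\<close> on \<open>X\<close>; there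
are only countably many \<open>i\<close>, so \<open>D\<close> would be settled.\<close>

lemma settled_split:
  fixes R :: "'i::countable \<Rightarrow> 'b \<Rightarrow> bool"
  assumes U: "is_ultrafilter UNIV UNIV U" and D: "\<not> settled U R D"
  shows "{i. \<not> settled U R {b \<in> D. R i b = t}} \<in> U"
proof (rule ccontr)
  let ?X = "{i. settled U R {b \<in> D. R i b = t}}"
  assume "{i. \<not> settled U R {b \<in> D. R i b = t}} \<notin> U"
  moreover have "- {i. \<not> settled U R {b \<in> D. R i b = t}} = ?X"
    by auto
  ultimately have X: "?X \<in> U"
    using ultrafilter_Compl_iff[OF U, of "{i. \<not> settled U R {b \<in> D. R i b = t}}"] by simp
  \<comment> \<open>\<open>E 0\<close> collects the points that \<open>?X\<close> settles at once, the other \<open>E n\<close> are the settled halves.\<close>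
  define E where "E n = (case n of
      0 \<Rightarrow> {b \<in> D. \<forall>i\<in>?X. R i b = (\<not> t)}
    | Suc m \<Rightarrow> (if (from_nat m :: 'i) \<in> ?X then {b \<in> D. R (from_nat m) b = t} else {}))" for n
  have "settled U R (E n)" for n
  proof (cases n)
    case 0
    have "settled U R {b. \<forall>i\<in>?X. R i b = (\<not> t)}"
      by (rule settled_homogeneous[OF X])
    then show ?thesis
      by (rule settled_subset) (auto simp: 0 E_def)
  next
    case (Suc m)
    then show ?thesis
      by (simp add: E_def settled_empty[OF U])
  qed
  then have "settled U R (\<Union>n. E n)"
    by (rule settled_UN_nat)
  moreover have "D \<subseteq> (\<Union>n. E n)"
  proof
    fix b assume b: "b \<in> D"
    show "b \<in> (\<Union>n. E n)"
    proof (cases "\<forall>i\<in>?X. R i b = (\<not> t)")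
      case True
      then have "b \<in> E 0"
        using b by (simp add: E_def)
      then show ?thesis
        by blast
    next
      case False
      then obtain i where "i \<in> ?X" "R i b = t"
        by blast
      then have "b \<in> E (Suc (to_nat i))"
        using b by (simp add: E_def)
      then show ?thesis
        by blast
    qed
  qed
  ultimately show False
    using D by (metis settled_subset)
qed

text \<open>The combinatorial core of an IP-witness. Patterns are lists indexed by an initial segment, since they
are built up one index at a time.\<close>

definition independent_seq :: "'b set \<Rightarrow> ('i \<Rightarrow> 'b \<Rightarrow> bool) \<Rightarrow> (nat \<Rightarrow> 'i) \<Rightarrow> bool" where
  "independent_seq K R n \<longleftrightarrow> (\<forall>m bs. length bs = m \<longrightarrow> (\<exists>b\<in>K. map (\<lambda>k. R (n k) b) [0..<m] = bs))"

text \<open>Keep all \<open>2 ^ m\<close> pattern sets of the first \<open>m\<close> indices unsettled. By \<open>settled_split\<close> almost every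
index halves any one of them into two unsettled sets, and finitely many conditions on the index that
hold almost surely can be met simultaneously.\<close>

lemma unsettled_imp_independent:
  fixes R :: "'i::countable \<Rightarrow> 'b \<Rightarrow> bool"
  assumes U: "is_ultrafilter UNIV UNIV U" and K: "\<not> settled U R K"
  shows "\<exists>n. independent_seq K R n"
proof -
  define D where "D l bs = {b \<in> K. map (\<lambda>i. R i b) l = bs}" for l bs
  define P where "P m l \<longleftrightarrow> length l = m \<and> (\<forall>bs. length bs = m \<longrightarrow> \<not> settled U R (D l bs))"
    for m and l :: "'i list"
  have "\<exists>f. \<forall>m. P m (f m) \<and> (\<exists>i. f (Suc m) = f m @ [i])"
  proof (rule dependent_nat_choice[where P = P and Q = "\<lambda>_ l l'. \<exists>i. l' = l @ [i]"])
    have "P 0 []"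
      using K by (simp add: P_def D_def)
    then show "\<exists>l. P 0 l"
      by blast
  next
    fix l m assume l: "P m l"
    let ?I = "{bs :: bool list. length bs = m} \<times> (UNIV :: bool set)"
    let ?X = "\<lambda>(bs, t). {i. \<not> settled U R {b \<in> D l bs. R i b = t}}"
    have "finite {bs :: bool list. length bs = m}"
      using finite_lists_length_eq[of "UNIV :: bool set" m] by simp
    then have "finite ?I"
      by simp
    moreover have "?X c \<in> U" if "c \<in> ?I" for c
    proof -
      obtain bs t where c: "c = (bs, t)"
        by (cases c)
      then have "\<not> settled U R (D l bs)"
        using l that by (simp add: P_def)
      from settled_split[OF U this] show ?thesis
        by (simp add: c)
    qed
    ultimately have "(\<Inter>c\<in>?I. ?X c) \<in> U"
      by (rule ultrafilter_finite_INT[OF U])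
    then have "(\<Inter>c\<in>?I. ?X c) \<noteq> {}"
      by (rule ultrafilter_nonempty[OF U])
    then obtain i where i: "\<And>bs t. length bs = m \<Longrightarrow> \<not> settled U R {b \<in> D l bs. R i b = t}"
      by auto
    have "P (Suc m) (l @ [i])"
      unfolding P_def
    proof (intro conjI allI impI)
      show "length (l @ [i]) = Suc m"
        using l by (simp add: P_def)
      fix bs :: "bool list" assume "length bs = Suc m"
      then obtain bs' t where bs: "bs = bs' @ [t]" "length bs' = m"
        by (metis length_Suc_conv_rev)
      moreover have "D (l @ [i]) (bs' @ [t]) = {b \<in> D l bs'. R i b = t}"
        by (auto simp: D_def)
      ultimately show "\<not> settled U R (D (l @ [i]) bs)"
        using i by simp
    qed
    then show "\<exists>l'. P (Suc m) l' \<and> (\<exists>i. l' = l @ [i])"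
      by blast
  qed
  then obtain f where P: "\<And>m. P m (f m)" and "\<forall>m. \<exists>i. f (Suc m) = f m @ [i]"
    by blast
  then obtain n where step: "\<And>m. f (Suc m) = f m @ [n m]"
    by metis
  have f: "f m = map n [0..<m]" for m
  proof (induction m)
    case 0
    then show ?case
      using P[of 0] by (simp add: P_def)
  qed (simp add: step)
  have "\<exists>b\<in>K. map (\<lambda>k. R (n k) b) [0..<m] = bs" if "length bs = m" for m bs
  proof -
    have "\<not> settled U R (D (f m) bs)"
      using P[of m] that by (simp add: P_def)
    then have "D (f m) bs \<noteq> {}"
      using settled_empty[OF U] by metis
    then show ?thesis
      by (auto simp: D_def f o_def)
  qed
  then show ?thesis
    by (auto simp: independent_seq_def)
qed

text \<open>If \<open>R i b\<close> is constant on a member of \<open>U\<close>, then the constant is the \<open>U\<close>-limit.\<close>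

lemma settled_imp_limit_sets:
  fixes R :: "'i \<Rightarrow> 'b \<Rightarrow> bool"
  assumes U: "is_ultrafilter UNIV UNIV U" and "settled U R K"
  shows "\<exists>X :: nat \<Rightarrow> 'i set. (\<forall>k. X k \<in> U) \<and> (\<forall>b\<in>K. \<exists>k. \<forall>i\<in>X k. R i b = ({i. R i b} \<in> U))"
proof -
  from assms obtain X :: "nat \<Rightarrow> 'i set"
    where X: "\<And>k. X k \<in> U" and K: "\<And>b. b \<in> K \<Longrightarrow> \<exists>k. \<exists>t. \<forall>i\<in>X k. R i b = t"
    unfolding settled_def by blast
  have t: "t = ({i. R i b} \<in> U)" if "\<forall>i\<in>X k. R i b = t" for b k t
  proof (cases t)
    case True
    then have "X k \<subseteq> {i. R i b}"
      using that by auto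
    then show ?thesis
      using True ultrafilter_mono[OF U X] by simp
  next
    case False
    then have "X k \<inter> {i. R i b} = {}"
      using that by auto
    then show ?thesis
      using False ultrafilter_nonempty[OF U ultrafilter_Int[OF U X]] by auto
  qed
  have "\<exists>k. \<forall>i\<in>X k. R i b = ({i. R i b} \<in> U)" if b: "b \<in> K" for b
  proof -
    from K[OF b] obtain k t where k: "\<forall>i\<in>X k. R i b = t"
      by (elim exE)
    show ?thesis
      by (rule exI[of _ k]) (use k t[OF k] in simp)
  qed
  then show ?thesis
    using X by (intro exI[of _ X]) simp
qed

lemma limit_sets_imp_convergent:
  assumes X: "\<And>b. b \<in> K \<Longrightarrow> \<exists>k. \<forall>i\<in>X k. R i b = t b"
    and p: "\<And>m :: nat. p m \<in> (\<Inter>k\<le>m. X k)" and b: "b \<in> K"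
  shows "eventual_truth_value (\<lambda>m. R (p m) b) (t b)"
proof -
  from X[OF b] obtain k where "\<forall>i\<in>X k. R i b = t b"
    by blast
  then have "\<forall>m\<ge>k. R (p m) b = t b"
    using p by blast
  then show ?thesis
    unfolding eventual_truth_value_def eventually_sequentially by blast
qed

lemma eventual_truth_value_unique:
  assumes "eventual_truth_value s t" "eventual_truth_value s t'"
  shows "t = t'"
proof -
  obtain m m' where "\<And>i. m \<le> i \<Longrightarrow> s i = t" "\<And>i. m' \<le> i \<Longrightarrow> s i = t'"
    using assms unfolding eventual_truth_value_def eventually_sequentially by blast
  from this(1)[of "max m m'"] this(2)[of "max m m'"] show ?thesis
    by simp
qed

section \<open>Ultrafilters on generated algebras\<close>

lemma algebra_hull:
  assumes "G \<subseteq> Pow \<Omega>"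
  shows "algebra \<Omega> (algebra \<Omega> hull G)"
proof -
  have "algebra \<Omega> hull G \<subseteq> Pow \<Omega>"
    using assms by (rule hull_minimal) (rule algebra_Pow)
  moreover have mem: "X \<in> algebra \<Omega> hull G \<longleftrightarrow> (\<forall>\<B>. algebra \<Omega> \<B> \<and> G \<subseteq> \<B> \<longrightarrow> X \<in> \<B>)" for X
    by (auto simp: hull_def)
  moreover have "{} \<in> algebra \<Omega> hull G"
    unfolding mem by (simp add: algebra_iff_Un)
  moreover have "\<Omega> - X \<in> algebra \<Omega> hull G" if "X \<in> algebra \<Omega> hull G" for X
    using that unfolding mem by (simp add: algebra_iff_Un)
  moreover have "X \<union> Y \<in> algebra \<Omega> hull G"
    if "X \<in> algebra \<Omega> hull G" "Y \<in> algebra \<Omega> hull G" for X Y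
    using that unfolding mem by (simp add: algebra_iff_Un)
  ultimately show ?thesis
    unfolding algebra_iff_Un by simp
qed

lemma algebra_hull_induct [consumes 2, case_names gen empty compl un]:
  assumes X: "X \<in> algebra \<Omega> hull G" and G: "G \<subseteq> Pow \<Omega>"
    and gen: "\<And>g. g \<in> G \<Longrightarrow> P g"
    and empty: "P {}"
    and compl: "\<And>X. X \<in> algebra \<Omega> hull G \<Longrightarrow> P X \<Longrightarrow> P (\<Omega> - X)"
    and un: "\<And>X Y. X \<in> algebra \<Omega> hull G \<Longrightarrow> Y \<in> algebra \<Omega> hull G \<Longrightarrow> P X \<Longrightarrow> P Y \<Longrightarrow> P (X \<union> Y)"
  shows "P X"
proof -
  note hull = iffD1[OF algebra_iff_Un algebra_hull[OF G]]
  have "algebra \<Omega> {X \<in> algebra \<Omega> hull G. P X}"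
    by (rule iffD2[OF algebra_iff_Un], intro conjI ballI) (use hull empty compl un in auto)
  moreover have "G \<subseteq> {X \<in> algebra \<Omega> hull G. P X}"
    using gen by (intro subsetI CollectI conjI hull_inc[of _ G]) auto
  ultimately have "algebra \<Omega> hull G \<subseteq> {X \<in> algebra \<Omega> hull G. P X}"
    by (rule hull_minimal[rotated])
  with X show ?thesis
    by blast
qed

lemma
  assumes "is_ultrafilter \<Omega> \<B> U"
  shows is_ultrafilter_Omega: "\<Omega> \<in> U"
    and is_ultrafilter_sets: "X \<in> U \<Longrightarrow> X \<in> \<B>"
    and is_ultrafilter_empty: "{} \<notin> U"
    and is_ultrafilter_Int: "X \<in> U \<Longrightarrow> Y \<in> U \<Longrightarrow> X \<inter> Y \<in> U"
    and is_ultrafilter_mono: "X \<in> U \<Longrightarrow> Y \<in> \<B> \<Longrightarrow> X \<subseteq> Y \<Longrightarrow> Y \<in> U"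
    and is_ultrafilter_cases: "X \<in> \<B> \<Longrightarrow> X \<in> U \<or> \<Omega> - X \<in> U"
  using assms unfolding is_ultrafilter_def by auto

lemma is_ultrafilter_Diff_iff:
  assumes "is_ultrafilter \<Omega> \<B> U" "X \<in> \<B>"
  shows "\<Omega> - X \<in> U \<longleftrightarrow> X \<notin> U"
proof -
  have "X \<inter> (\<Omega> - X) = {}"
    by blast
  then have "\<not> (X \<in> U \<and> \<Omega> - X \<in> U)"
    using is_ultrafilter_Int[OF assms(1), of X "\<Omega> - X"] is_ultrafilter_empty[OF assms(1)] by auto
  then show ?thesis
    using is_ultrafilter_cases[OF assms] by blast
qed

lemma is_ultrafilter_Un_iff:
  assumes "is_ultrafilter \<Omega> \<B> U" "algebra \<Omega> \<B>" "X \<in> \<B>" "Y \<in> \<B>"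
  shows "X \<union> Y \<in> U \<longleftrightarrow> X \<in> U \<or> Y \<in> U"
proof
  have un: "X \<union> Y \<in> \<B>"
    using assms(2-4) by (auto simp: algebra_iff_Un)
  {
    assume "X \<in> U \<or> Y \<in> U"
    then show "X \<union> Y \<in> U"
      using is_ultrafilter_mono[OF assms(1) _ un] by blast
  }
  show "X \<in> U \<or> Y \<in> U" if "X \<union> Y \<in> U"
  proof (rule ccontr)
    assume "\<not> (X \<in> U \<or> Y \<in> U)"
    then have "\<Omega> - X \<in> U" "\<Omega> - Y \<in> U"
      using is_ultrafilter_Diff_iff[OF assms(1)] assms(3,4) by blast+
    then have "(X \<union> Y) \<inter> ((\<Omega> - X) \<inter> (\<Omega> - Y)) \<in> U"
      using that is_ultrafilter_Int[OF assms(1)] by blast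
    moreover have "(X \<union> Y) \<inter> ((\<Omega> - X) \<inter> (\<Omega> - Y)) = {}"
      by blast
    ultimately show False
      using is_ultrafilter_empty[OF assms(1)] by simp
  qed
qed

lemma is_ultrafilter_hull_eqI:
  assumes G: "G \<subseteq> Pow \<Omega>"
    and U: "is_ultrafilter \<Omega> (algebra \<Omega> hull G) U" and V: "is_ultrafilter \<Omega> (algebra \<Omega> hull G) V"
    and gens: "\<And>g. g \<in> G \<Longrightarrow> g \<in> U \<longleftrightarrow> g \<in> V"
  shows "U = V"
proof -
  have "X \<in> U \<longleftrightarrow> X \<in> V" if "X \<in> algebra \<Omega> hull G" for X
    using that G
  proof (induction rule: algebra_hull_induct)
    case (gen g)
    then show ?case
      by (rule gens)
  next
    case empty
    then show ?case
      using is_ultrafilter_empty[OF U] is_ultrafilter_empty[OF V] by simp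
  next
    case (compl X)
    then show ?case
      using is_ultrafilter_Diff_iff[OF U] is_ultrafilter_Diff_iff[OF V] by simp
  next
    case (un X Y)
    then show ?case
      using is_ultrafilter_Un_iff[OF U algebra_hull[OF G]] is_ultrafilter_Un_iff[OF V algebra_hull[OF G]]
      by simp
  qed
  then show ?thesis
    using is_ultrafilter_sets[OF U] is_ultrafilter_sets[OF V] by blast
qed

lemma hull_trace:
  assumes T: "T \<subseteq> \<Omega>" and G: "G \<subseteq> Pow \<Omega>"
  shows "(\<lambda>X. X \<inter> T) ` (algebra \<Omega> hull G) = algebra T hull ((\<lambda>X. X \<inter> T) ` G)"
proof
  let ?t = "\<lambda>X. X \<inter> T"
  have G': "?t ` G \<subseteq> Pow T"
    by blast
  note hull = iffD1[OF algebra_iff_Un algebra_hull[OF G]]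
  note hull' = iffD1[OF algebra_iff_Un algebra_hull[OF G']]
  have "X \<inter> T \<in> algebra T hull (?t ` G)" if "X \<in> algebra \<Omega> hull G" for X
    using that G
  proof (induction rule: algebra_hull_induct)
    case (gen g)
    then show ?case
      by (rule hull_inc[OF imageI])
  next
    case empty
    then show ?case
      using hull' by simp
  next
    case (compl X)
    have "(\<Omega> - X) \<inter> T = T - X \<inter> T"
      using T by blast
    then show ?case
      using hull' compl by simp
  next
    case (un X Y)
    then show ?case
      using hull' by (simp add: Int_Un_distrib2)
  qed
  then show "?t ` (algebra \<Omega> hull G) \<subseteq> algebra T hull (?t ` G)"
    by blast
  show "algebra T hull (?t ` G) \<subseteq> ?t ` (algebra \<Omega> hull G)"
  proof (rule hull_minimal)
    show "?t ` G \<subseteq> ?t ` (algebra \<Omega> hull G)"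
      by (intro image_mono hull_subset)
    have "T - X \<inter> T \<in> ?t ` (algebra \<Omega> hull G)" if "X \<in> algebra \<Omega> hull G" for X
    proof -
      have "T - X \<inter> T = (\<Omega> - X) \<inter> T"
        using T by blast
      moreover have "\<Omega> - X \<in> algebra \<Omega> hull G"
        using hull that by blast
      ultimately show ?thesis
        by (rule image_eqI)
    qed
    moreover have "X \<inter> T \<union> Y \<inter> T \<in> ?t ` (algebra \<Omega> hull G)"
      if "X \<in> algebra \<Omega> hull G" "Y \<in> algebra \<Omega> hull G" for X Y
    proof -
      have "X \<inter> T \<union> Y \<inter> T = (X \<union> Y) \<inter> T"
        by blast
      moreover have "X \<union> Y \<in> algebra \<Omega> hull G"
        using hull that by blast
      ultimately show ?thesis
        by (rule image_eqI)
    qed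
    moreover have "{} \<in> ?t ` (algebra \<Omega> hull G)"
      using hull by (intro image_eqI[of _ _ "{}"]) auto
    ultimately show "algebra T (?t ` (algebra \<Omega> hull G))"
      by (intro iffD2[OF algebra_iff_Un] conjI) auto
  qed
qed

text \<open>The sets of the algebra that contain the point \<open>b\<close> form an ultrafilter, and restricting to \<open>T\<close> loses
nothing because each of these sets meets \<open>T\<close>. This is how \<open>b\<close> in a large model defines a type
over a small one.\<close>

lemma is_ultrafilter_trace_at:
  assumes \<B>: "algebra \<Omega> \<B>" and T: "T \<subseteq> \<Omega>" and b: "b \<in> \<Omega>"
    and dense: "\<And>X. X \<in> \<B> \<Longrightarrow> b \<in> X \<Longrightarrow> X \<inter> T \<noteq> {}"
  shows "is_ultrafilter T ((\<lambda>X. X \<inter> T) ` \<B>) ((\<lambda>X. X \<inter> T) ` {X \<in> \<B>. b \<in> X})"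
proof -
  interpret algebra \<Omega> \<B>
    by (rule \<B>)
  let ?t = "\<lambda>X. X \<inter> T"
  let ?U = "?t ` {X \<in> \<B>. b \<in> X}"
  show ?thesis
    unfolding is_ultrafilter_def
  proof (intro conjI ballI impI)
    show "?U \<subseteq> ?t ` \<B>"
      by blast
    show "T \<in> ?U"
      using T b top by (intro image_eqI[of _ _ \<Omega>]) auto
    show "{} \<notin> ?U"
      using dense by fastforce
    show "X \<inter> Y \<in> ?U" if X: "X \<in> ?U" and Y: "Y \<in> ?U" for X Y
    proof -
      obtain X' where X': "X = X' \<inter> T" "X' \<in> \<B>" "b \<in> X'"
        using X by blast
      obtain Y' where Y': "Y = Y' \<inter> T" "Y' \<in> \<B>" "b \<in> Y'"
        using Y by blast
      have "X \<inter> Y = (X' \<inter> Y') \<inter> T"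
        using X'(1) Y'(1) by blast
      then show ?thesis
        using X' Y' by (intro image_eqI[of _ _ "X' \<inter> Y'"]) auto
    qed
    show "Y \<in> ?U" if X: "X \<in> ?U" and Y: "Y \<in> ?t ` \<B>" and "X \<subseteq> Y" for X Y
    proof -
      obtain X' where X': "X = X' \<inter> T" "X' \<in> \<B>" "b \<in> X'"
        using X by blast
      obtain Y' where Y': "Y = Y' \<inter> T" "Y' \<in> \<B>"
        using Y by blast
      have "(X' - Y') \<inter> T = {}"
        using \<open>X \<subseteq> Y\<close> X'(1) Y'(1) by blast
      then have "b \<notin> X' - Y'"
        using dense[of "X' - Y'"] X'(2) Y'(2) by blast
      then show ?thesis
        using X'(3) Y' by blast
    qed
    show "X \<in> ?U \<or> T - X \<in> ?U" if X: "X \<in> ?t ` \<B>" for X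
    proof -
      obtain X' where X': "X = X' \<inter> T" "X' \<in> \<B>"
        using X by blast
      show ?thesis
      proof (cases "b \<in> X'")
        case True
        then show ?thesis
          using X' by blast
      next
        case False
        have "T - X = (\<Omega> - X') \<inter> T"
          using X'(1) T by blast
        moreover have "\<Omega> - X' \<in> {X \<in> \<B>. b \<in> X}"
          using False b X'(2) by auto
        ultimately have "T - X \<in> ?U"
          by (rule image_eqI)
        then show ?thesis ..
      qed
    qed
  qed
qed

lemma is_ultrafilter_image:
  assumes U: "is_ultrafilter UNIV UNIV U" and \<B>: "algebra \<Omega> \<B>" and a: "range a \<subseteq> \<Omega>"
  shows "is_ultrafilter \<Omega> \<B> {X \<in> \<B>. {i. a i \<in> X} \<in> U}"
proof -
  interpret algebra \<Omega> \<B>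
    by (rule \<B>)
  show ?thesis
    unfolding is_ultrafilter_def
  proof (intro conjI ballI impI)
    have "{i. a i \<in> \<Omega>} = UNIV"
      using a by auto
    then show "\<Omega> \<in> {X \<in> \<B>. {i. a i \<in> X} \<in> U}"
      using top ultrafilter_UNIV[OF U] by simp
    show "{} \<notin> {X \<in> \<B>. {i. a i \<in> X} \<in> U}"
      using ultrafilter_nonempty[OF U] by auto
    show "X \<inter> Y \<in> {X \<in> \<B>. {i. a i \<in> X} \<in> U}"
      if "X \<in> {X \<in> \<B>. {i. a i \<in> X} \<in> U}" "Y \<in> {X \<in> \<B>. {i. a i \<in> X} \<in> U}" for X Y
    proof -
      have "{i. a i \<in> X \<inter> Y} = {i. a i \<in> X} \<inter> {i. a i \<in> Y}"
        by blast
      moreover have "X \<inter> Y \<in> \<B>"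
        using that by (intro Int) auto
      ultimately show ?thesis
        using that ultrafilter_Int[OF U] by simp
    qed
    show "Y \<in> {X \<in> \<B>. {i. a i \<in> X} \<in> U}"
      if "X \<in> {X \<in> \<B>. {i. a i \<in> X} \<in> U}" "Y \<in> \<B>" "X \<subseteq> Y" for X Y
    proof -
      have "{i. a i \<in> X} \<subseteq> {i. a i \<in> Y}"
        using that(3) by blast
      then show ?thesis
        using that(1,2) ultrafilter_mono[OF U] by blast
    qed
    show "X \<in> {X \<in> \<B>. {i. a i \<in> X} \<in> U} \<or> \<Omega> - X \<in> {X \<in> \<B>. {i. a i \<in> X} \<in> U}" if "X \<in> \<B>" for X
    proof -
      have "{i. a i \<in> \<Omega> - X} = - {i. a i \<in> X}"
        using a by auto
      then show ?thesis
        using that ultrafilter_Compl_iff[OF U, of "{i. a i \<in> X}"] compl_sets by auto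
    qed
  qed auto
qed

text \<open>Names for the members of an algebra with countably many generators, so that there are no more members
than terms.\<close>

datatype bool_term = Gen nat | Zero | Minus bool_term | Join bool_term bool_term

instance bool_term :: countable
  by countable_datatype

lemma countable_algebra_hull:
  assumes G: "G \<subseteq> Pow \<Omega>" and "countable G"
  shows "countable (algebra \<Omega> hull G)"
proof -
  obtain g :: "nat \<Rightarrow> 'a set" where g: "insert {} G = range g"
    using uncountable_def[of "insert {} G"] \<open>countable G\<close> by auto
  define val where "val = rec_bool_term g {} (\<lambda>_ X. \<Omega> - X) (\<lambda>_ _ X Y. X \<union> Y)"
  have "X \<in> range val" if "X \<in> algebra \<Omega> hull G" for X
    using that G
  proof (induction rule: algebra_hull_induct)
    case (gen X)
    then obtain n where "X = g n"
      using g by blast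
    then have "X = val (Gen n)"
      by (simp add: val_def)
    then show ?case
      by blast
  next
    case empty
    have "{} = val Zero"
      by (simp add: val_def)
    then show ?case
      by blast
  next
    case (compl X)
    then obtain t where "X = val t"
      by blast
    then have "\<Omega> - X = val (Minus t)"
      by (simp add: val_def)
    then show ?case
      by blast
  next
    case (un X Y)
    then obtain s t where "X = val s" "Y = val t"
      by blast
    then have "X \<union> Y = val (Join s t)"
      by (simp add: val_def)
    then show ?case
      by blast
  qed
  then have "algebra \<Omega> hull G \<subseteq> range val"
    by blast
  then show ?thesis
    by (rule countable_subset) simp
qed

lemma inst_image_subset: "inst P \<phi> zs ws ` C \<subseteq> Pow (tuples P (length zs))"
  by (auto simp: inst_def)

lemma algebra_inst: "algebra (tuples P (length zs)) (inst_algebra P \<phi> zs ws C)"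
  unfolding inst_algebra_def by (rule algebra_hull[OF inst_image_subset])

lemma inst_in_algebra: "c \<in> C \<Longrightarrow> inst P \<phi> zs ws c \<in> inst_algebra P \<phi> zs ws C"
  unfolding inst_algebra_def by (rule hull_inc[OF imageI])

section \<open>The number of Borel sets of a countable Stone space\<close>

lemma card_of_countable_fun:
  "|UNIV :: ('i::countable \<Rightarrow> 'j::countable) set| \<le>o |UNIV :: nat set set|"
proof -
  have "inj (\<lambda>f :: 'i \<Rightarrow> 'j. range (\<lambda>i. to_nat (i, f i)))"
  proof (rule injI)
    fix f g :: "'i \<Rightarrow> 'j"
    assume eq: "range (\<lambda>i. to_nat (i, f i)) = range (\<lambda>i. to_nat (i, g i))"
    show "f = g"
    proof
      fix i
      have "to_nat (i, f i) \<in> range (\<lambda>i. to_nat (i, g i))"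
        unfolding eq[symmetric] by blast
      then show "f i = g i"
        by auto
    qed
  qed
  then show ?thesis
    by (intro card_of_ordLeqI) auto
qed

text \<open>Names for the members of a \<open>\<sigma>\<close>-algebra with countably many generators. They make induction on
countable ordinals unnecessary: a code is a well-founded tree, and there are only continuum many
labellings of the tree of finite sequences.\<close>

datatype borel_code = Base nat | Empty | Compl borel_code | Union "nat \<Rightarrow> borel_code"

text \<open>The label of the node reached along a path. The values 0, 1, 2 mark the other constructors, and
generators are shifted by 3 to be different from them.\<close>

primrec borel_tree :: "borel_code \<Rightarrow> nat list \<Rightarrow> nat" where
  "borel_tree (Base n) = (\<lambda>_. n + 3)"
| "borel_tree Empty = (\<lambda>_. 0)"
| "borel_tree (Compl c) = (\<lambda>p. case p of [] \<Rightarrow> 1 | _ # q \<Rightarrow> borel_tree c q)"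
| "borel_tree (Union f) = (\<lambda>p. case p of [] \<Rightarrow> 2 | i # q \<Rightarrow> borel_tree (f i) q)"

lemma inj_borel_tree: "inj borel_tree"
proof -
  have "borel_tree c = borel_tree d \<Longrightarrow> c = d" for c d
  proof (induction c arbitrary: d)
    case (Base n)
    from fun_cong[OF Base, of "[]"] show ?case
      by (cases d) simp_all
  next
    case Empty
    from fun_cong[OF Empty, of "[]"] show ?case
      by (cases d) simp_all
  next
    case (Compl c)
    from fun_cong[OF Compl.prems, of "[]"] obtain d' where d: "d = Compl d'"
      by (cases d) simp_all
    have "borel_tree c q = borel_tree d' q" for q
      using fun_cong[OF Compl.prems, of "0 # q"] d by simp
    then show ?case
      using Compl.IH d by blast
  next
    case (Union f)
    from fun_cong[OF Union.prems, of "[]"] obtain g where d: "d = Union g"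
      by (cases d) simp_all
    have "borel_tree (f i) q = borel_tree (g i) q" for i q
      using fun_cong[OF Union.prems, of "i # q"] d by simp
    then have "f i = g i" for i
      using Union.IH by blast
    then show ?case
      using d by blast
  qed
  then show ?thesis
    by (rule injI)
qed

lemma card_of_sigma_sets:
  fixes \<Omega> :: "'a set"
  assumes "countable G"
  shows "|sigma_sets \<Omega> G| \<le>o |UNIV :: nat set set|"
proof -
  obtain g :: "nat \<Rightarrow> 'a set" where g: "insert {} G = range g"
    using uncountable_def[of "insert {} G"] assms by auto
  define val where "val = rec_borel_code g {} (\<lambda>_ X. \<Omega> - X) (\<lambda>f. \<Union>i. snd (f i))"
  have val: "val (Base n) = g n" "val Empty = {}" "val (Compl c) = \<Omega> - val c"
      "val (Union f) = (\<Union>i. val (f i))" for n c f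
    by (simp_all add: val_def)
  have "X \<in> range val" if "X \<in> sigma_sets \<Omega> G" for X
    using that
  proof induction
    case (Basic X)
    then obtain n where "X = g n"
      using g by blast
    then have "X = val (Base n)"
      by (simp add: val)
    then show ?case
      by blast
  next
    case Empty
    have "{} = val Empty"
      by (simp add: val)
    then show ?case
      by blast
  next
    case (Compl X)
    then obtain c where "X = val c"
      by blast
    then have "\<Omega> - X = val (Compl c)"
      by (simp add: val)
    then show ?case
      by blast
  next
    case (Union X)
    then have "\<forall>i. \<exists>c. X i = val c"
      by blast
    from choice[OF this] obtain f where "\<forall>i. X i = val (f i)"
      by blast
    then have "(\<Union>i. X i) = val (Union f)"
      by (simp add: val)
    then show ?case
      by blast
  qed
  then have "|sigma_sets \<Omega> G| \<le>o |UNIV :: borel_code set|"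
    by (intro surj_imp_ordLeq[where f = val]) blast
  also have "|UNIV :: borel_code set| \<le>o |UNIV :: (nat list \<Rightarrow> nat) set|"
    using inj_borel_tree by (intro card_of_ordLeqI) auto
  also have "|UNIV :: (nat list \<Rightarrow> nat) set| \<le>o |UNIV :: nat set set|"
    by (rule card_of_countable_fun)
  finally show ?thesis .
qed

text \<open>The subbasis is closed under finite intersections, hence a basis; for a countable algebra this makes
every open set a countable union of clopen sets.\<close>

lemma openin_stone_topology_cover:
  assumes \<B>: "algebra \<Omega> \<B>" and V: "openin (stone_topology \<Omega> \<B>) V"
  shows "V = (\<Union>X\<in>{X \<in> \<B>. {U. is_ultrafilter \<Omega> \<B> U \<and> X \<in> U} \<subseteq> V}. {U. is_ultrafilter \<Omega> \<B> U \<and> X \<in> U})"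
proof -
  interpret algebra \<Omega> \<B>
    by (rule \<B>)
  note Int_in = Int
  let ?C = "\<lambda>X. {U. is_ultrafilter \<Omega> \<B> U \<and> X \<in> U}"
  have "generate_topology_on {?C X |X. X \<in> \<B>} V"
    using V unfolding stone_topology_def by (rule openin_topology_generated_by)
  then have "\<exists>X\<in>\<B>. q \<in> ?C X \<and> ?C X \<subseteq> V" if "q \<in> V" for q
    using that
  proof (induction arbitrary: q)
    case Empty
    then show ?case
      by simp
  next
    case (Int V W)
    obtain X where X: "X \<in> \<B>" "q \<in> ?C X" "?C X \<subseteq> V"
      using Int.IH(1) Int.prems by blast
    obtain Y where Y: "Y \<in> \<B>" "q \<in> ?C Y" "?C Y \<subseteq> W"
      using Int.IH(2) Int.prems by blast
    have "?C (X \<inter> Y) \<subseteq> ?C X \<inter> ?C Y"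
      using X(1) Y(1) is_ultrafilter_mono by blast
    moreover have "q \<in> ?C (X \<inter> Y)"
      using X(2) Y(2) is_ultrafilter_Int by blast
    moreover have "X \<inter> Y \<in> \<B>"
      using X(1) Y(1) by (rule Int_in)
    ultimately show ?case
      using X(3) Y(3) by blast
  next
    case (UN K)
    then obtain W where W: "W \<in> K" "q \<in> W"
      by blast
    with UN.IH[OF W] show ?case
      by blast
  next
    case (Basis W)
    then show ?case
      by blast
  qed
  then show ?thesis
    by blast
qed

lemma topspace_stone_topology:
  assumes "algebra \<Omega> \<B>"
  shows "topspace (stone_topology \<Omega> \<B>) = {U. is_ultrafilter \<Omega> \<B> U}"
proof -
  interpret algebra \<Omega> \<B>
    by (rule assms)
  have "\<Union>{{U. is_ultrafilter \<Omega> \<B> U \<and> X \<in> U} |X. X \<in> \<B>} = {U. is_ultrafilter \<Omega> \<B> U}"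
    using top is_ultrafilter_Omega by blast
  then show ?thesis
    by (simp add: stone_topology_def)
qed

lemma card_of_borel_sets_stone_topology:
  assumes \<B>: "algebra \<Omega> \<B>" and "countable \<B>"
  shows "|borel_sets_of (stone_topology \<Omega> \<B>)| \<le>o |UNIV :: nat set set|"
proof -
  let ?T = "stone_topology \<Omega> \<B>"
  let ?C = "\<lambda>X. {U. is_ultrafilter \<Omega> \<B> U \<and> X \<in> U}"
  have space: "?C ` \<B> \<subseteq> Pow (topspace ?T)"
    using topspace_stone_topology[OF \<B>] by blast
  interpret S: sigma_algebra "topspace ?T" "sigma_sets (topspace ?T) (?C ` \<B>)"
    using space by (rule sigma_algebra_sigma_sets)
  have "V \<in> sigma_sets (topspace ?T) (?C ` \<B>)" if "openin ?T V" for V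
  proof -
    let ?I = "{X \<in> \<B>. ?C X \<subseteq> V}"
    have "(\<Union>X\<in>?I. ?C X) \<in> sigma_sets (topspace ?T) (?C ` \<B>)"
    proof (rule S.countable_UN')
      show "countable ?I"
        using \<open>countable \<B>\<close> by (rule countable_subset[rotated]) blast
      show "?C ` ?I \<subseteq> sigma_sets (topspace ?T) (?C ` \<B>)"
        by (auto intro!: sigma_sets.Basic)
    qed
    then show ?thesis
      using openin_stone_topology_cover[OF \<B> that] by simp
  qed
  then have "borel_sets_of ?T \<subseteq> sigma_sets (topspace ?T) (?C ` \<B>)"
    unfolding borel_sets_of_def by (intro sigma_sets_mono) blast
  then have "|borel_sets_of ?T| \<le>o |sigma_sets (topspace ?T) (?C ` \<B>)|"
    by (rule card_of_mono1)
  also have "|sigma_sets (topspace ?T) (?C ` \<B>)| \<le>o |UNIV :: nat set set|"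
    using \<open>countable \<B>\<close> by (intro card_of_sigma_sets) simp
  finally show ?thesis .
qed

section \<open>Many ultrafilters on a countable set\<close>

text \<open>The independent family of Fichtenholz, Kantorovich and Hausdorff, with lists in place of finite sets
so that the index type is visibly countable: \<open>(l, ls)\<close> stands for the condition that the trace of \<open>S\<close>
on the finite set \<open>l\<close> is one of finitely many listed traces.\<close>

definition filter_code :: "nat set \<Rightarrow> (nat list \<times> nat list list) set" where
  "filter_code S = {(l, ls). filter (\<lambda>n. n \<in> S) l \<in> set ls}"

text \<open>Choose \<open>l\<close> so that distinct members of \<open>F\<close> have distinct traces on it, and list the traces of the
members of \<open>\<T>\<close>.\<close>

lemma filter_code_independent:
  assumes "finite F"
  shows "\<exists>i. \<forall>S\<in>F. i \<in> filter_code S \<longleftrightarrow> S \<in> \<T>"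
proof -
  define d where "d S S' = (SOME n. (n \<in> S) \<noteq> (n \<in> S'))" for S S' :: "nat set"
  have d: "(d S S' \<in> S) \<noteq> (d S S' \<in> S')" if "S \<noteq> S'" for S S'
  proof -
    have "\<exists>n. (n \<in> S) \<noteq> (n \<in> S')"
      using that by blast
    then show ?thesis
      unfolding d_def by (rule someI_ex)
  qed
  have "finite (case_prod d ` (F \<times> F))"
    using assms by simp
  then obtain l where l: "set l = case_prod d ` (F \<times> F)"
    using finite_list by blast
  obtain ls where ls: "set ls = (\<lambda>S. filter (\<lambda>n. n \<in> S) l) ` (F \<inter> \<T>)"
    using assms finite_list[of "(\<lambda>S. filter (\<lambda>n. n \<in> S) l) ` (F \<inter> \<T>)"] by auto
  have inj: "S = S'" if S: "S \<in> F" "S' \<in> F" and eq: "filter (\<lambda>n. n \<in> S) l = filter (\<lambda>n. n \<in> S') l" for S S'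
  proof (rule ccontr)
    assume "S \<noteq> S'"
    have "d S S' \<in> set l"
      unfolding l using S by (intro image_eqI[of _ _ "(S, S')"]) auto
    moreover have "set l \<inter> S = set l \<inter> S'"
      using arg_cong[OF eq, of set] by (simp add: Int_def)
    ultimately show False
      using d[OF \<open>S \<noteq> S'\<close>] by blast
  qed
  have "(l, ls) \<in> filter_code S \<longleftrightarrow> S \<in> \<T>" if "S \<in> F" for S
    using inj[OF that] that ls by (auto simp: filter_code_def)
  then show ?thesis
    by blast
qed

text \<open>Since \<open>\<T>\<close> is arbitrary, a countable set carries at least as many ultrafilters as there are sets
of sets of numbers (Pospisil).\<close>

lemma ultrafilter_prescribed:
  "\<exists>U. is_ultrafilter UNIV UNIV U \<and> (\<forall>S. filter_code S \<in> U \<longleftrightarrow> S \<in> \<T>)"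
proof -
  define E where "E S = (if S \<in> \<T> then filter_code S else - filter_code S)" for S
  have "\<exists>U. is_ultrafilter UNIV UNIV U \<and> range E \<subseteq> U"
  proof (rule ultrafilter_exists)
    fix \<F> assume \<F>: "finite \<F>" "\<F> \<subseteq> range E"
    obtain F where F: "finite F" "\<F> = E ` F"
      using finite_subset_image[OF \<F>] by blast
    obtain i where "\<forall>S\<in>F. i \<in> filter_code S \<longleftrightarrow> S \<in> \<T>"
      using filter_code_independent[OF F(1)] by blast
    then have "i \<in> \<Inter>\<F>"
      using F(2) by (auto simp: E_def)
    then show "\<Inter>\<F> \<noteq> {}"
      by blast
  qed
  then obtain U where U: "is_ultrafilter UNIV UNIV U" and E: "\<And>S. E S \<in> U"
    by blast
  have "filter_code S \<in> U \<longleftrightarrow> S \<in> \<T>" for S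
    using E[of S] ultrafilter_Compl_iff[OF U] by (auto simp: E_def split: if_splits)
  then show ?thesis
    using U by blast
qed

section \<open>Assignments and relocated formulas\<close>

lemma eval_trm_cong: "(\<And>v. v \<in> fv_trm t \<Longrightarrow> e v = e' v) \<Longrightarrow> eval_trm M e t = eval_trm M e' t"
proof (induction t)
  case (Fn f ts)
  then have "map (eval_trm M e) ts = map (eval_trm M e') ts"
    by (intro map_cong refl) auto
  then show ?case
    by (simp only: eval_trm.simps)
qed simp

lemma sat_cong: "(\<And>v. v \<in> fv \<psi> \<Longrightarrow> e v = e' v) \<Longrightarrow> sat M e \<psi> = sat M e' \<psi>"
proof (induction \<psi> arbitrary: e e')
  case (Eq s t)
  then show ?case
    using eval_trm_cong[of s e e' M] eval_trm_cong[of t e e' M] by simp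
next
  case (Rel r ts)
  then have "map (eval_trm M e) ts = map (eval_trm M e') ts"
    by (intro map_cong refl eval_trm_cong) auto
  then show ?case
    by (simp only: sat.simps)
next
  case (Neg \<psi>)
  have "sat M e \<psi> = sat M e' \<psi>"
    by (rule Neg.IH) (simp add: Neg.prems)
  then show ?case
    by simp
next
  case (Conj \<psi>1 \<psi>2)
  have "sat M e \<psi>1 = sat M e' \<psi>1"
    by (rule Conj.IH(1)) (simp add: Conj.prems)
  moreover have "sat M e \<psi>2 = sat M e' \<psi>2"
    by (rule Conj.IH(2)) (simp add: Conj.prems)
  ultimately show ?case
    by simp
next
  case (Ex x \<psi>)
  have "sat M (e(x := m)) \<psi> = sat M (e'(x := m)) \<psi>" for m
    by (rule Ex.IH) (simp add: Ex.prems)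
  then show ?case
    by simp
qed

lemma upd_notin: "v \<notin> set vs \<Longrightarrow> upd e vs c v = e v"
  by (auto simp: upd_def split: option.split dest: map_of_SomeD set_zip_leftD)

lemma upd_nth: "distinct vs \<Longrightarrow> i < length vs \<Longrightarrow> length c = length vs \<Longrightarrow> upd e vs c (vs ! i) = c ! i"
  by (simp add: upd_def map_of_zip_nth)

lemma upd_cong: "e v = e' v \<Longrightarrow> upd e vs c v = upd e' vs c v"
  by (simp add: upd_def split: option.split)

lemma upd_Cons:
  assumes "v \<notin> set vs"
  shows "upd e (v # vs) (m # c) = upd (e(v := m)) vs c"
proof
  fix w
  show "upd e (v # vs) (m # c) w = upd (e(v := m)) vs c w"
  proof (cases "w = v")
    case True
    moreover have "upd (e(v := m)) vs c v = m"
      using upd_notin[OF assms, of "e(v := m)"] by simp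
    ultimately show ?thesis
      by (simp add: upd_def[of e])
  qed (simp add: upd_def split: option.split)
qed

lemma upd_append:
  assumes "length a = length xs"
  shows "upd e (xs @ ys) (a @ b) = upd (upd e ys b) xs a"
proof
  fix v
  show "upd e (xs @ ys) (a @ b) v = upd (upd e ys b) xs a v"
    using assms by (cases "map_of (zip xs a) v") (simp_all add: upd_def map_add_def del: map_of_zip_is_None)
qed

lemma upd_commute:
  assumes "set xs \<inter> set ys = {}"
  shows "upd (upd e ys b) xs a = upd (upd e xs a) ys b"
proof
  fix v
  show "upd (upd e ys b) xs a v = upd (upd e xs a) ys b v"
  proof (cases "v \<in> set xs")
    case True
    then have "v \<notin> set ys"
      using assms by auto
    then have "upd (upd e xs a) ys b v = upd e xs a v"
      by (rule upd_notin)
    moreover have "upd (upd e ys b) xs a v = upd e xs a v"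
      by (rule upd_cong) (rule upd_notin[OF \<open>v \<notin> set ys\<close>])
    ultimately show ?thesis
      by simp
  next
    case False
    then have "upd (upd e ys b) xs a v = upd e ys b v"
      by (rule upd_notin)
    moreover have "upd (upd e xs a) ys b v = upd e ys b v"
      by (rule upd_cong) (rule upd_notin[OF False])
    ultimately show ?thesis
      by simp
  qed
qed

lemma upd_in_univ:
  assumes "distinct vs" "c \<in> tuples M (length vs)" "v \<in> set vs"
  shows "upd e vs c v \<in> univ M"
proof -
  from assms(3) obtain i where "i < length vs" "v = vs ! i"
    by (auto simp: in_set_conv_nth)
  then show ?thesis
    using assms(1,2) by (auto simp: upd_nth tuples_def)
qed

lemma sat_foldr_Ex:
  "distinct vs \<Longrightarrow> sat M e (foldr Ex vs \<psi>) \<longleftrightarrow> (\<exists>c\<in>tuples M (length vs). sat M (upd e vs c) \<psi>)"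
proof (induction vs arbitrary: e)
  case Nil
  then show ?case
    by (simp add: tuples_def upd_def)
next
  case (Cons v vs)
  have "sat M e (foldr Ex (v # vs) \<psi>) \<longleftrightarrow>
      (\<exists>m\<in>univ M. \<exists>c\<in>tuples M (length vs). sat M (upd e (v # vs) (m # c)) \<psi>)"
    using Cons by (simp add: upd_Cons)
  also have "\<dots> \<longleftrightarrow> (\<exists>c\<in>tuples M (length (v # vs)). sat M (upd e (v # vs) c) \<psi>)"
  proof
    assume "\<exists>m\<in>univ M. \<exists>c\<in>tuples M (length vs). sat M (upd e (v # vs) (m # c)) \<psi>"
    then obtain m c where "m \<in> univ M" "c \<in> tuples M (length vs)" "sat M (upd e (v # vs) (m # c)) \<psi>"
      by blast
    moreover from this have "m # c \<in> tuples M (length (v # vs))"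
      by (simp add: tuples_def)
    ultimately show "\<exists>c\<in>tuples M (length (v # vs)). sat M (upd e (v # vs) c) \<psi>"
      by blast
  next
    assume "\<exists>c\<in>tuples M (length (v # vs)). sat M (upd e (v # vs) c) \<psi>"
    then obtain c where c: "c \<in> tuples M (length (v # vs))" "sat M (upd e (v # vs) c) \<psi>"
      by blast
    then obtain m c' where "c = m # c'"
      by (cases c) (auto simp: tuples_def)
    then show "\<exists>m\<in>univ M. \<exists>c\<in>tuples M (length vs). sat M (upd e (v # vs) (m # c)) \<psi>"
      using c by (auto simp: tuples_def)
  qed
  finally show ?case .
qed

lemma sat_foldr_Conj: "sat M e (foldr Conj \<psi>s \<theta>) \<longleftrightarrow> (\<forall>\<psi>\<in>set \<psi>s. sat M e \<psi>) \<and> sat M e \<theta>"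
  by (induction \<psi>s) auto

lemma wf_foldr_Conj: "wf_fm L (foldr Conj \<psi>s \<theta>) \<longleftrightarrow> (\<forall>\<psi>\<in>set \<psi>s. wf_fm L \<psi>) \<and> wf_fm L \<theta>"
  by (induction \<psi>s) auto

lemma wf_foldr_Ex: "wf_fm L (foldr Ex vs \<psi>) \<longleftrightarrow> wf_fm L \<psi>"
  by (induction vs) auto

text \<open>\<open>\<phi>\<close> with the free variables \<open>vs\<close> in place of \<open>xs\<close>, as \<open>\<exists>xs. xs = vs \<and> \<phi>\<close>. This avoids substitution
and its problem of variable capture.\<close>

definition relocate :: "('f, 'r) fm \<Rightarrow> nat list \<Rightarrow> nat list \<Rightarrow> ('f, 'r) fm" where
  "relocate \<phi> xs vs = foldr Ex xs (foldr Conj (map2 (\<lambda>x v. Eq (Var x) (Var v)) xs vs) \<phi>)"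

lemma wf_relocate: "wf_fm L \<phi> \<Longrightarrow> wf_fm L (relocate \<phi> xs vs)"
  by (auto simp: relocate_def wf_foldr_Ex wf_foldr_Conj)

lemma sat_relocate:
  assumes "distinct xs" "set xs \<inter> set vs = {}" "length vs = length xs" "e ` set vs \<subseteq> univ M"
  shows "sat M e (relocate \<phi> xs vs) \<longleftrightarrow> sat M (upd e xs (map e vs)) \<phi>"
proof -
  have eqs: "(\<forall>\<psi>\<in>set (map2 (\<lambda>x v. Eq (Var x) (Var v)) xs vs). sat M (upd e xs c) \<psi>) \<longleftrightarrow> c = map e vs"
    if c: "c \<in> tuples M (length xs)" for c
  proof -
    have len: "length c = length xs"
      using c by (simp add: tuples_def)
    have "(\<forall>\<psi>\<in>set (map2 (\<lambda>x v. Eq (Var x) (Var v)) xs vs). sat M (upd e xs c) \<psi>) \<longleftrightarrow>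
        (\<forall>i<length xs. upd e xs c (xs ! i) = upd e xs c (vs ! i))"
      using assms(3) by (auto simp: set_zip)
    also have "\<dots> \<longleftrightarrow> (\<forall>i<length xs. c ! i = e (vs ! i))"
    proof -
      have "upd e xs c (xs ! i) = c ! i \<and> upd e xs c (vs ! i) = e (vs ! i)" if "i < length xs" for i
      proof
        show "upd e xs c (xs ! i) = c ! i"
          using assms(1) that len by (rule upd_nth)
        have "vs ! i \<in> set vs"
          using that assms(3) by simp
        then show "upd e xs c (vs ! i) = e (vs ! i)"
          using assms(2) by (intro upd_notin) auto
      qed
      then show ?thesis
        by auto
    qed
    also have "\<dots> \<longleftrightarrow> c = map e vs"
      using len assms(3) by (simp add: list_eq_iff_nth_eq)
    finally show ?thesis .
  qed
  have "map e vs \<in> tuples M (length xs)"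
    using assms(3,4) by (simp add: tuples_def)
  then show ?thesis
    unfolding relocate_def sat_foldr_Ex[OF assms(1)] sat_foldr_Conj using eqs by blast
qed

section \<open>Realizing finite and infinite patterns\<close>

locale saturated_ext =
  fixes L :: "('f, 'r) lang"
    and M N :: "('f, 'r, 'm) struc"
    and \<phi> :: "('f, 'r) fm"
    and xs ys :: "nat list"
    and A :: "'m list set"
  assumes ext: "elem_ext L M N"
    and saturated: "saturated L (cardSuc |univ M| ) N"
    and wf: "wf_fm L \<phi>"
    and dist: "distinct (xs @ ys)"
    and fv: "fv \<phi> \<subseteq> set (xs @ ys)"
    and A: "A \<subseteq> tuples M (length xs)"
begin

abbreviation R :: "'m list \<Rightarrow> 'm list \<Rightarrow> bool" where
  "R \<equiv> holds N \<phi> xs ys"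

abbreviation T :: "'m list set" where
  "T \<equiv> tuples N (length ys)"

lemma univ_mono: "univ M \<subseteq> univ N"
  using ext by (simp add: elem_ext_def)

lemma tuples_mono: "tuples M n \<subseteq> tuples N n"
  using univ_mono by (auto simp: tuples_def)

lemma holds_iff:
  assumes "length a = length xs" "length b = length ys"
  shows "holds P \<phi> xs ys a b \<longleftrightarrow> sat P (upd (upd e xs a) ys b) \<phi>"
proof -
  have disj: "set xs \<inter> set ys = {}"
    using dist by simp
  show ?thesis
    unfolding holds_def upd_append[OF assms(1)] upd_commute[OF disj]
  proof (rule sat_cong)
    fix v assume "v \<in> fv \<phi>"
    then have "v \<in> set xs \<or> v \<in> set ys"
      using fv by auto
    moreover have xs: "upd e xs a v = upd e' xs a v" if v: "v \<in> set xs" for e e'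
    proof -
      obtain i where "i < length xs" "v = xs ! i"
        using v by (auto simp: in_set_conv_nth)
      then show ?thesis
        using dist assms by (simp add: upd_nth)
    qed
    moreover have ys: "upd e ys b v = upd e' ys b v" if v: "v \<in> set ys" for e e'
    proof -
      obtain i where "i < length ys" "v = ys ! i"
        using v by (auto simp: in_set_conv_nth)
      then show ?thesis
        using dist assms(2) by (simp add: upd_nth)
    qed
    moreover have "v \<in> set xs \<Longrightarrow> v \<notin> set ys"
      using disj by auto
    ultimately show "upd (upd (\<lambda>_. undefined) xs a) ys b v = upd (upd e xs a) ys b v"
      by (metis upd_notin)
  qed
qed

lemma holds_swap:
  assumes "length a = length xs" "length b = length ys"
  shows "holds P \<phi> ys xs b a = holds P \<phi> xs ys a b"
proof -
  have disj: "set ys \<inter> set xs = {}"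
    using dist by auto
  show ?thesis
    unfolding holds_def upd_append[OF assms(1)] upd_append[OF assms(2)] upd_commute[OF disj] ..
qed

lemma sat_M_iff: "wf_fm L \<psi> \<Longrightarrow> e ` fv \<psi> \<subseteq> univ M \<Longrightarrow> sat M e \<psi> \<longleftrightarrow> sat N e \<psi>"
  using ext unfolding elem_ext_def by (elim conjE allE[where x = \<psi>] allE[where x = e] impE) auto

lemma holds_M_iff:
  assumes "a \<in> tuples M (length xs)" "b \<in> tuples M (length ys)"
  shows "holds M \<phi> xs ys a b = R a b"
proof -
  have ab: "a @ b \<in> tuples M (length (xs @ ys))"
    using assms by (simp add: tuples_def)
  have "upd (\<lambda>_. undefined) (xs @ ys) (a @ b) ` fv \<phi> \<subseteq> univ M"
    using fv upd_in_univ[OF dist ab] by blast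
  then show ?thesis
    unfolding holds_def by (rule sat_M_iff[OF wf])
qed

text \<open>The pattern is expressed by one sentence \<open>\<exists>ys. \<dots>\<close> with parameters in \<open>M\<close>. Since \<open>\<phi>\<close> occurs with
several parameter tuples, each tuple needs variables of its own, which relocation provides.\<close>

lemma pattern_in_M:
  assumes F: "finite F" "F \<subseteq> tuples M (length xs)" and b: "b \<in> T"
  shows "\<exists>b'\<in>tuples M (length ys). \<forall>a\<in>F. R a b' = R a b"
proof -
  obtain as where as: "set as = F"
    using F(1) finite_list by blast
  have as_M: "as ! i \<in> tuples M (length xs)" if "i < length as" for i
    using F(2) nth_mem[OF that] unfolding as by (rule subsetD)
  have "univ M \<noteq> {}"
    using ext by (simp add: elem_ext_def is_struc_def)
  then obtain m0 where m0: "m0 \<in> univ M"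
    by blast
  \<comment> \<open>Variable blocks: \<open>vs i\<close> lies above all variables of \<open>xs\<close> and \<open>ys\<close>, and the pairing function keeps the blocks apart.\<close>
  define base where "base = Suc (Max (insert 0 (set (xs @ ys))))"
  have base: "v < base" if "v \<in> set (xs @ ys)" for v
    using that unfolding base_def by (auto simp: less_Suc_eq_le intro: Max_ge)
  define vs where "vs i = map (\<lambda>j. base + prod_encode (i, j)) [0..<length xs]" for i
  define e where "e v = (case prod_decode (v - base) of (i, j) \<Rightarrow>
      if i < length as \<and> j < length xs then as ! i ! j else m0)" for v
  have lit: "sat P (upd e ys c) (relocate \<phi> xs (vs i)) \<longleftrightarrow> holds P \<phi> xs ys (as ! i) c"
    if i: "i < length as" and c: "c \<in> tuples P (length ys)" and P: "univ M \<subseteq> univ P" for P c i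
  proof -
    note a = as_M[OF i]
    have disj: "set xs \<inter> set (vs i) = {}" "set ys \<inter> set (vs i) = {}"
      using base unfolding vs_def by fastforce+
    have "map (upd e ys c) (vs i) = map e (vs i)"
      using disj(2) by (intro map_cong refl upd_notin) auto
    also have "\<dots> = as ! i"
      using a i by (intro nth_equalityI) (auto simp: vs_def e_def tuples_def)
    finally have vals: "map (upd e ys c) (vs i) = as ! i" .
    have "upd e ys c ` set (vs i) \<subseteq> univ P"
      using a P vals by (metis (no_types, lifting) list.set_map mem_Collect_eq order_trans tuples_def)
    moreover have "distinct xs" "length (vs i) = length xs"
      using dist by (simp_all add: vs_def)
    ultimately have "sat P (upd e ys c) (relocate \<phi> xs (vs i)) \<longleftrightarrow> sat P (upd (upd e ys c) xs (as ! i)) \<phi>"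
      using sat_relocate[of xs "vs i" "upd e ys c" P \<phi>] disj(1) vals by simp
    also have "\<dots> \<longleftrightarrow> holds P \<phi> xs ys (as ! i) c"
      using holds_iff[of "as ! i" c P e] a c upd_commute[of xs ys e c "as ! i"] dist
      by (simp add: tuples_def)
    finally show ?thesis .
  qed
  define \<psi> where "\<psi> i = (if R (as ! i) b then relocate \<phi> xs (vs i) else Neg (relocate \<phi> xs (vs i)))" for i
  define \<Psi> where "\<Psi> = foldr Ex ys (foldr Conj (map \<psi> [0..<length as]) (Eq (Var 0) (Var 0)))"
  have sat_\<Psi>: "sat P e \<Psi> \<longleftrightarrow>
      (\<exists>c\<in>tuples P (length ys). \<forall>i<length as. holds P \<phi> xs ys (as ! i) c = R (as ! i) b)"
    if P: "univ M \<subseteq> univ P" for P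
  proof -
    have \<psi>: "sat P (upd e ys c) (\<psi> i) \<longleftrightarrow> holds P \<phi> xs ys (as ! i) c = R (as ! i) b"
      if "i < length as" "c \<in> tuples P (length ys)" for i c
      using lit[OF that P] by (simp add: \<psi>_def)
    have "sat P e \<Psi> \<longleftrightarrow> (\<exists>c\<in>tuples P (length ys). \<forall>i\<in>{0..<length as}. sat P (upd e ys c) (\<psi> i))"
      using dist by (simp add: \<Psi>_def sat_foldr_Ex sat_foldr_Conj)
    also have "\<dots> \<longleftrightarrow>
        (\<exists>c\<in>tuples P (length ys). \<forall>i<length as. holds P \<phi> xs ys (as ! i) c = R (as ! i) b)"
      by (rule bex_cong[OF refl]) (auto simp: \<psi>)
    finally show ?thesis .
  qed
  have "wf_fm L \<Psi>"
    unfolding \<Psi>_def wf_foldr_Ex wf_foldr_Conj by (auto simp: \<psi>_def intro: wf_relocate[OF wf])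
  moreover have "e v \<in> univ M" for v
  proof -
    have "as ! i ! j \<in> univ M" if "i < length as" "j < length xs" for i j
    proof -
      have "as ! i ! j \<in> set (as ! i)"
        using as_M[OF that(1)] that(2) by (intro nth_mem) (simp add: tuples_def)
      then show ?thesis
        using as_M[OF that(1)] unfolding tuples_def by blast
    qed
    then show ?thesis
      using m0 by (simp add: e_def split: prod.split)
  qed
  ultimately have "sat M e \<Psi> \<longleftrightarrow> sat N e \<Psi>"
    by (intro sat_M_iff) auto
  moreover have "sat N e \<Psi>"
    using sat_\<Psi>[OF univ_mono] b by blast
  ultimately obtain c where c: "c \<in> tuples M (length ys)"
    and *: "\<And>i. i < length as \<Longrightarrow> holds M \<phi> xs ys (as ! i) c = R (as ! i) b"
    using sat_\<Psi>[OF order_refl] by blast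
  have "R a c = R a b" if "a \<in> F" for a
  proof -
    from that have "a \<in> set as"
      by (simp add: as)
    then obtain i where i: "i < length as" "a = as ! i"
      by (auto simp: in_set_conv_nth)
    have "R a c = holds M \<phi> xs ys a c"
      using holds_M_iff[OF as_M[OF i(1)] c] i(2) by simp
    then show ?thesis
      using *[OF i(1)] i(2) by simp
  qed
  then show ?thesis
    using c by blast
qed

lemma pattern_realized:
  assumes C: "C \<subseteq> tuples M (length xs)"
    and fin: "\<And>F. finite F \<Longrightarrow> F \<subseteq> C \<Longrightarrow> \<exists>b\<in>T. \<forall>a\<in>F. R a b \<longleftrightarrow> a \<in> S"
  shows "\<exists>b\<in>T. \<forall>a\<in>C. R a b \<longleftrightarrow> a \<in> S"
proof -
  define g where "g a = (if a \<in> S then \<phi> else Neg \<phi>, upd (\<lambda>_. undefined) xs a)" for a :: "'m list"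
  have g: "sat N (upd (snd (g a)) ys b) (fst (g a)) \<longleftrightarrow> (R a b \<longleftrightarrow> a \<in> S)"
    if "a \<in> C" "b \<in> T" for a b
    using holds_iff[of a b N "\<lambda>_. undefined"] that C tuples_mono by (auto simp: g_def tuples_def)
  have "|univ M| <o cardSuc |univ M|"
    by (rule cardSuc_greater) (rule card_of_Card_order)
  moreover have "distinct ys"
    using dist by simp
  moreover have "\<forall>(\<psi>, e)\<in>g ` C. wf_fm L \<psi> \<and> e ` (fv \<psi> - set ys) \<subseteq> univ M"
  proof -
    have "upd (\<lambda>_. undefined) xs a ` (fv \<phi> - set ys) \<subseteq> univ M" if "a \<in> C" for a
      using fv dist C that by (auto intro!: upd_in_univ)
    then show ?thesis
      using wf by (auto simp: g_def)
  qed
  moreover have "\<exists>b\<in>T. \<forall>(\<psi>, e)\<in>\<Delta>. sat N (upd e ys b) \<psi>" if "finite \<Delta>" "\<Delta> \<subseteq> g ` C" for \<Delta>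
  proof -
    obtain F where F: "F \<subseteq> C" "finite F" "\<Delta> = g ` F"
      using finite_subset_image[OF \<open>finite \<Delta>\<close> \<open>\<Delta> \<subseteq> g ` C\<close>] by blast
    then obtain b where b: "b \<in> T" "\<forall>a\<in>F. R a b \<longleftrightarrow> a \<in> S"
      using fin by blast
    then have "\<forall>a\<in>F. sat N (upd (snd (g a)) ys b) (fst (g a))"
      using F(1) g by blast
    then show ?thesis
      using b(1) F(3) by (auto simp: case_prod_beta)
  qed
  ultimately have "\<exists>b\<in>T. \<forall>(\<psi>, e)\<in>g ` C. sat N (upd e ys b) \<psi>"
    using univ_mono saturated[unfolded saturated_def, rule_format, of "univ M" ys "g ` C"] by blast
  then obtain b where b: "b \<in> T" "\<forall>(\<psi>, e)\<in>g ` C. sat N (upd e ys b) \<psi>"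
    by blast
  then have "\<forall>a\<in>C. sat N (upd (snd (g a)) ys b) (fst (g a))"
    by (simp add: case_prod_beta)
  then show ?thesis
    using b(1) g by blast
qed

section \<open>Types over A and types finitely satisfiable in A\<close>

abbreviation TM :: "'m list set" where
  "TM \<equiv> tuples M (length ys)"

lemma TM_subset: "TM \<subseteq> T"
  by (rule tuples_mono)

lemma A_length: "a \<in> A \<Longrightarrow> length a = length xs"
  using A by (auto simp: tuples_def)

lemma T_length: "b \<in> T \<Longrightarrow> length b = length ys"
  by (simp add: tuples_def)

lemma inst_opp_N: "a \<in> A \<Longrightarrow> inst N \<phi> ys xs a = {b \<in> T. R a b}"
  using holds_swap[OF A_length T_length] by (auto simp: inst_def)

lemma inst_opp_M: "a \<in> A \<Longrightarrow> inst M \<phi> ys xs a = inst N \<phi> ys xs a \<inter> TM"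
proof -
  assume a: "a \<in> A"
  have "holds M \<phi> ys xs b a = R a b" if "b \<in> TM" for b
    using holds_swap[of a b M] holds_M_iff[of a b] a A that A_length[OF a] T_length[of b] TM_subset by blast
  then show ?thesis
    unfolding inst_opp_N[OF a] using TM_subset by (auto simp: inst_def)
qed

lemma inst_algebra_M: "inst_algebra M \<phi> ys xs A = (\<lambda>X. X \<inter> TM) ` inst_algebra N \<phi> ys xs A"
proof -
  have "inst M \<phi> ys xs ` A = (\<lambda>X. X \<inter> TM) ` (inst N \<phi> ys xs ` A)"
    by (simp add: image_image inst_opp_M cong: image_cong)
  then show ?thesis
    unfolding inst_algebra_def by (simp add: hull_trace[OF TM_subset inst_image_subset])
qed

text \<open>A Boolean combination mentions only finitely many parameters.\<close>

lemma inst_algebra_finite_support: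
  assumes "X \<in> inst_algebra N \<phi> ys xs A"
  shows "\<exists>F. finite F \<and> F \<subseteq> A \<and>
    (\<forall>b\<in>T. \<forall>b'\<in>T. (\<forall>a\<in>F. R a b = R a b') \<longrightarrow> (b \<in> X \<longleftrightarrow> b' \<in> X))"
  using assms[unfolded inst_algebra_def] inst_image_subset
proof (induction rule: algebra_hull_induct)
  case (gen X)
  then obtain a where a: "a \<in> A" "X = inst N \<phi> ys xs a"
    by blast
  then show ?case
    by (intro exI[of _ "{a}"]) (simp add: inst_opp_N)
next
  case empty
  show ?case
    by (intro exI[of _ "{}"]) simp
next
  case (compl X)
  then obtain F where F: "finite F" "F \<subseteq> A"
    "\<forall>b\<in>T. \<forall>b'\<in>T. (\<forall>a\<in>F. R a b = R a b') \<longrightarrow> (b \<in> X \<longleftrightarrow> b' \<in> X)"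
    by blast
  show ?case
  proof (intro exI[of _ F] conjI ballI impI)
    fix b b' assume b: "b \<in> T" "b' \<in> T" and eq: "\<forall>a\<in>F. R a b = R a b'"
    from F(3) b eq have "b \<in> X \<longleftrightarrow> b' \<in> X"
      by blast
    with b show "b \<in> T - X \<longleftrightarrow> b' \<in> T - X"
      by blast
  qed (fact F)+
next
  case (un X Y)
  then obtain F G where F: "finite F" "F \<subseteq> A"
    "\<forall>b\<in>T. \<forall>b'\<in>T. (\<forall>a\<in>F. R a b = R a b') \<longrightarrow> (b \<in> X \<longleftrightarrow> b' \<in> X)"
    and G: "finite G" "G \<subseteq> A"
    "\<forall>b\<in>T. \<forall>b'\<in>T. (\<forall>a\<in>G. R a b = R a b') \<longrightarrow> (b \<in> Y \<longleftrightarrow> b' \<in> Y)"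
    by blast
  show ?case
  proof (intro exI[of _ "F \<union> G"] conjI ballI impI)
    fix b b' assume b: "b \<in> T" "b' \<in> T" and eq: "\<forall>a\<in>F \<union> G. R a b = R a b'"
    from F(3) b eq have "b \<in> X \<longleftrightarrow> b' \<in> X"
      by blast
    moreover from G(3) b eq have "b \<in> Y \<longleftrightarrow> b' \<in> Y"
      by blast
    ultimately show "b \<in> X \<union> Y \<longleftrightarrow> b' \<in> X \<union> Y"
      by simp
  qed (use F(1,2) G(1,2) in auto)
qed

text \<open>Membership in \<open>X\<close> depends on finitely many truth values \<open>R a b\<close>, and the pattern that they form is also
realized in \<open>M\<close>.\<close>

lemma inst_algebra_meets_M:
  assumes X: "X \<in> inst_algebra N \<phi> ys xs A" and b: "b \<in> X"
  shows "X \<inter> TM \<noteq> {}"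
proof -
  obtain F where F: "finite F" "F \<subseteq> A"
    and supp: "\<And>b b'. b \<in> T \<Longrightarrow> b' \<in> T \<Longrightarrow> (\<forall>a\<in>F. R a b = R a b') \<Longrightarrow> (b \<in> X \<longleftrightarrow> b' \<in> X)"
    using inst_algebra_finite_support[OF X] by blast
  have "X \<subseteq> T"
    using X algebra_inst[of N ys \<phi> xs A] by (auto simp: algebra_iff_Un)
  then have bT: "b \<in> T"
    using b by blast
  obtain b' where b': "b' \<in> TM" "\<forall>a\<in>F. R a b' = R a b"
    using pattern_in_M[OF F(1) order_trans[OF F(2) A] bT] by blast
  have "b' \<in> X"
    using supp[of b' b] b' b bT TM_subset by blast
  then show ?thesis
    using b'(1) by blast
qed

lemma tp_opp_in_S_opp:
  assumes "b \<in> T"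
  shows "tp_opp M N \<phi> xs ys A b \<in> S_opp M \<phi> xs ys A"
  unfolding tp_opp_def S_opp_def types_def inst_algebra_M
  by (rule CollectI, rule is_ultrafilter_trace_at[OF algebra_inst TM_subset assms inst_algebra_meets_M])

lemma inst_in_tp_opp_iff:
  assumes b: "b \<in> T" and a: "a \<in> A"
  shows "inst M \<phi> ys xs a \<in> tp_opp M N \<phi> xs ys A b \<longleftrightarrow> R a b"
proof
  let ?X = "inst N \<phi> ys xs a"
  note alg = iffD1[OF algebra_iff_Un algebra_inst[of N ys \<phi> xs A]]
  have X: "?X \<in> inst_algebra N \<phi> ys xs A"
    by (rule inst_in_algebra[OF a])
  have uf: "is_ultrafilter TM (inst_algebra M \<phi> ys xs A) (tp_opp M N \<phi> xs ys A b)"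
    using tp_opp_in_S_opp[OF b] by (simp add: S_opp_def types_def)
  show "inst M \<phi> ys xs a \<in> tp_opp M N \<phi> xs ys A b" if "R a b"
  proof -
    have "?X \<in> {X \<in> inst_algebra N \<phi> ys xs A. b \<in> X}"
      using X b that by (simp add: inst_opp_N[OF a])
    then show ?thesis
      unfolding tp_opp_def inst_opp_M[OF a] by (rule imageI)
  qed
  show "R a b" if mem: "inst M \<phi> ys xs a \<in> tp_opp M N \<phi> xs ys A b"
  proof (rule ccontr)
    assume "\<not> R a b"
    then have "T - ?X \<in> {X \<in> inst_algebra N \<phi> ys xs A. b \<in> X}"
      using X alg b by (simp add: inst_opp_N[OF a])
    then have "(T - ?X) \<inter> TM \<in> tp_opp M N \<phi> xs ys A b"
      unfolding tp_opp_def by (rule imageI)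
    moreover have "(T - ?X) \<inter> TM = TM - inst M \<phi> ys xs a"
      unfolding inst_opp_M[OF a] using TM_subset by blast
    ultimately show False
      using is_ultrafilter_Diff_iff[OF uf inst_in_algebra[OF a]] mem by simp
  qed
qed

lemma S_opp_eqI:
  assumes "q \<in> S_opp M \<phi> xs ys A" "q' \<in> S_opp M \<phi> xs ys A"
    and "\<And>a. a \<in> A \<Longrightarrow> inst M \<phi> ys xs a \<in> q \<longleftrightarrow> inst M \<phi> ys xs a \<in> q'"
  shows "q = q'"
proof (rule is_ultrafilter_hull_eqI[OF inst_image_subset])
  show "is_ultrafilter TM (algebra TM hull inst M \<phi> ys xs ` A) q"
    "is_ultrafilter TM (algebra TM hull inst M \<phi> ys xs ` A) q'"
    using assms(1,2) by (simp_all add: S_opp_def types_def inst_algebra_def)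
  show "g \<in> q \<longleftrightarrow> g \<in> q'" if "g \<in> inst M \<phi> ys xs ` A" for g
    using that assms(3) by blast
qed

text \<open>An ultrafilter contains the conjunction of any finitely many of its literals, so finite parts of the
type are realized in \<open>M\<close>, and saturation realizes the whole type.\<close>

lemma S_opp_realized:
  assumes q: "q \<in> S_opp M \<phi> xs ys A"
  shows "\<exists>b\<in>T. tp_opp M N \<phi> xs ys A b = q"
proof -
  have uf: "is_ultrafilter TM (inst_algebra M \<phi> ys xs A) q"
    using q by (simp add: S_opp_def types_def)
  let ?S = "{a \<in> A. inst M \<phi> ys xs a \<in> q}"
  define lit where "lit a = (if a \<in> ?S then inst M \<phi> ys xs a else TM - inst M \<phi> ys xs a)" for a
  have lit: "lit a \<in> q" if "a \<in> A" for a
    using is_ultrafilter_Diff_iff[OF uf inst_in_algebra[OF that]] that by (simp add: lit_def)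
  have lit_iff: "R a b \<longleftrightarrow> a \<in> ?S" if "a \<in> A" "b \<in> lit a" for a b
    using that TM_subset inst_opp_N[OF that(1)] inst_opp_M[OF that(1)] by (auto simp: lit_def split: if_splits)
  have "\<exists>b\<in>T. \<forall>a\<in>F. R a b \<longleftrightarrow> a \<in> ?S" if F: "finite F" "F \<subseteq> A" for F
  proof -
    have "TM \<inter> (\<Inter>a\<in>F. lit a) \<in> q"
      using F
    proof (induction F)
      case empty
      then show ?case
        using is_ultrafilter_Omega[OF uf] by simp
    next
      case (insert a F)
      have "TM \<inter> (\<Inter>a\<in>insert a F. lit a) = lit a \<inter> (TM \<inter> (\<Inter>a\<in>F. lit a))"
        by auto
      then show ?case
        using insert is_ultrafilter_Int[OF uf lit[of a]] by simp
    qed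
    then have "TM \<inter> (\<Inter>a\<in>F. lit a) \<noteq> {}"
      using is_ultrafilter_empty[OF uf] by auto
    then obtain b where b: "b \<in> TM" "\<And>a. a \<in> F \<Longrightarrow> b \<in> lit a"
      by blast
    have "\<forall>a\<in>F. R a b \<longleftrightarrow> a \<in> ?S"
      using lit_iff b(2) F(2) by blast
    then show ?thesis
      using b(1) TM_subset by blast
  qed
  then obtain b where b: "b \<in> T" "\<forall>a\<in>A. R a b \<longleftrightarrow> a \<in> ?S"
    using pattern_realized[OF A, of ?S] by blast
  have "tp_opp M N \<phi> xs ys A b = q"
  proof (rule S_opp_eqI[OF tp_opp_in_S_opp[OF b(1)] q])
    fix a assume "a \<in> A"
    then show "inst M \<phi> ys xs a \<in> tp_opp M N \<phi> xs ys A b \<longleftrightarrow> inst M \<phi> ys xs a \<in> q"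
      using inst_in_tp_opp_iff[OF b(1)] b(2) by simp
  qed
  then show ?thesis
    using b(1) by blast
qed

abbreviation fs_types :: "'m list set set set" where
  "fs_types \<equiv> fin_sat_types N \<phi> xs ys A"

abbreviation phi_in :: "'m list set set \<Rightarrow> 'm list \<Rightarrow> bool" where
  "phi_in \<equiv> phi_at N \<phi> xs ys"

lemma fin_sat_type_ultrafilter:
  "p \<in> fs_types \<Longrightarrow> is_ultrafilter (tuples N (length xs)) (inst_algebra N \<phi> xs ys T) p"
  by (simp add: fin_sat_types_def S_phi_def types_def)

lemma fin_sat_type_eqI:
  assumes "p \<in> fs_types" "p' \<in> fs_types" and "\<And>b. b \<in> T \<Longrightarrow> phi_in p b = phi_in p' b"
  shows "p = p'"
proof (rule is_ultrafilter_hull_eqI[OF inst_image_subset])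
  show "is_ultrafilter (tuples N (length xs)) (algebra (tuples N (length xs)) hull inst N \<phi> xs ys ` T) p"
    "is_ultrafilter (tuples N (length xs)) (algebra (tuples N (length xs)) hull inst N \<phi> xs ys ` T) p'"
    using fin_sat_type_ultrafilter assms(1,2) by (simp_all add: inst_algebra_def)
  show "g \<in> p \<longleftrightarrow> g \<in> p'" if "g \<in> inst N \<phi> xs ys ` T" for g
    using that assms(3) by (auto simp: phi_at_def)
qed

lemma A_subset_N: "A \<subseteq> tuples N (length xs)"
  using A tuples_mono by blast

lemma inst_iff: "a \<in> A \<Longrightarrow> a \<in> inst N \<phi> xs ys b \<longleftrightarrow> R a b"
  using A_subset_N by (auto simp: inst_def)

text \<open>The traces on \<open>A\<close> of the members of \<open>p\<close> have the finite intersection property, because \<open>p\<close> is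
finitely satisfiable in \<open>A\<close>; any ultrafilter that contains them will do.\<close>

lemma fin_sat_type_ultrafilter_on_index:
  fixes a :: "'i \<Rightarrow> 'm list"
  assumes p: "p \<in> fs_types" and a: "range a = A"
  shows "\<exists>U. is_ultrafilter UNIV UNIV U \<and> (\<forall>b\<in>T. phi_in p b \<longleftrightarrow> {i. R (a i) b} \<in> U)"
proof -
  note uf = fin_sat_type_ultrafilter[OF p]
  have "\<exists>U. is_ultrafilter UNIV UNIV U \<and> (\<lambda>X. {i. a i \<in> X}) ` p \<subseteq> U"
  proof (rule ultrafilter_exists)
    fix \<F> assume \<F>: "finite \<F>" "\<F> \<subseteq> (\<lambda>X. {i. a i \<in> X}) ` p"
    obtain \<X> where \<X>: "\<X> \<subseteq> p" "finite \<X>" "\<F> = (\<lambda>X. {i. a i \<in> X}) ` \<X>"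
      using finite_subset_image[OF \<F>] by blast
    from \<X>(2,1) have "tuples N (length xs) \<inter> \<Inter>\<X> \<in> p"
    proof (induction \<X>)
      case empty
      then show ?case
        using is_ultrafilter_Omega[OF uf] by simp
    next
      case (insert X \<X>)
      have "tuples N (length xs) \<inter> \<Inter>(insert X \<X>) = X \<inter> (tuples N (length xs) \<inter> \<Inter>\<X>)"
        by auto
      then show ?case
        using insert is_ultrafilter_Int[OF uf] by simp
    qed
    then obtain c where "c \<in> A" "c \<in> \<Inter>\<X>"
      using p by (auto simp: fin_sat_types_def)
    then show "\<Inter>\<F> \<noteq> {}"
      using a \<X>(3) by blast
  qed
  then obtain U where U: "is_ultrafilter UNIV UNIV U" and sub: "\<And>X. X \<in> p \<Longrightarrow> {i. a i \<in> X} \<in> U"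
    by blast
  have "phi_in p b \<longleftrightarrow> {i. R (a i) b} \<in> U" if b: "b \<in> T" for b
  proof -
    let ?X = "inst N \<phi> xs ys b"
    have "a i \<in> A" for i
      using a by blast
    then have pos: "{i. a i \<in> ?X} = {i. R (a i) b}" and neg: "{i. a i \<in> tuples N (length xs) - ?X} = - {i. R (a i) b}"
      using inst_iff A_subset_N by auto
    have "?X \<in> p \<or> tuples N (length xs) - ?X \<in> p"
      by (rule is_ultrafilter_cases[OF uf inst_in_algebra[OF b]])
    then have "?X \<in> p \<and> {i. R (a i) b} \<in> U \<or> ?X \<notin> p \<and> - {i. R (a i) b} \<in> U"
      using sub[of ?X] sub[of "tuples N (length xs) - ?X"] pos neg
        is_ultrafilter_Diff_iff[OF uf inst_in_algebra[OF b]] by auto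
    then show ?thesis
      using ultrafilter_Compl_iff[OF U] by (auto simp: phi_at_def)
  qed
  then show ?thesis
    using U by blast
qed

lemma fin_sat_type_of_ultrafilter:
  fixes a :: "'i \<Rightarrow> 'm list"
  assumes U: "is_ultrafilter UNIV UNIV U" and a: "range a \<subseteq> A"
  shows "\<exists>p\<in>fs_types. \<forall>b\<in>T. phi_in p b \<longleftrightarrow> {i. R (a i) b} \<in> U"
proof -
  let ?p = "{X \<in> inst_algebra N \<phi> xs ys T. {i. a i \<in> X} \<in> U}"
  have "range a \<subseteq> tuples N (length xs)"
    using a A_subset_N by blast
  then have "is_ultrafilter (tuples N (length xs)) (inst_algebra N \<phi> xs ys T) ?p"
    by (rule is_ultrafilter_image[OF U algebra_inst])
  moreover have "\<exists>c\<in>A. c \<in> X" if "X \<in> ?p" for X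
  proof -
    have "{i. a i \<in> X} \<noteq> {}"
      using that by (intro ultrafilter_nonempty[OF U]) simp
    then show ?thesis
      using a by blast
  qed
  ultimately have "?p \<in> fs_types"
    by (simp add: fin_sat_types_def S_phi_def types_def)
  moreover have "phi_in ?p b \<longleftrightarrow> {i. R (a i) b} \<in> U" if "b \<in> T" for b
  proof -
    have "a i \<in> A" for i
      using a by blast
    then have "{i. a i \<in> inst N \<phi> xs ys b} = {i. R (a i) b}"
      using inst_iff by simp
    then show ?thesis
      using inst_in_algebra[OF that, of N \<phi> xs ys] by (simp add: phi_at_def)
  qed
  ultimately show ?thesis
    by blast
qed

text \<open>Otherwise \<open>\<phi>(x, b) \<and> \<not> \<phi>(x, b')\<close>, or the same with \<open>b\<close> and \<open>b'\<close> exchanged, belongs to \<open>p\<close> and is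
therefore satisfied by some \<open>a \<in> A\<close>.\<close>

lemma phi_in_invariant:
  assumes p: "p \<in> fs_types" and b: "b \<in> T" "b' \<in> T" and eq: "\<And>a. a \<in> A \<Longrightarrow> R a b = R a b'"
  shows "phi_in p b = phi_in p b'"
proof -
  have imp: "phi_in p c'" if c: "c \<in> T" "c' \<in> T" "\<And>a. a \<in> A \<Longrightarrow> R a c = R a c'" "phi_in p c" for c c'
  proof (rule ccontr)
    note uf = fin_sat_type_ultrafilter[OF p]
    assume "\<not> phi_in p c'"
    then have "tuples N (length xs) - inst N \<phi> xs ys c' \<in> p"
      using is_ultrafilter_Diff_iff[OF uf inst_in_algebra[OF c(2)]] by (simp add: phi_at_def)
    then have "inst N \<phi> xs ys c \<inter> (tuples N (length xs) - inst N \<phi> xs ys c') \<in> p"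
      using c(4) is_ultrafilter_Int[OF uf] by (simp add: phi_at_def)
    then obtain a where "a \<in> A" "a \<in> inst N \<phi> xs ys c" "a \<notin> inst N \<phi> xs ys c'"
      using p by (auto simp: fin_sat_types_def)
    then show False
      using c(3) inst_iff by simp
  qed
  show ?thesis
    using imp[OF b eq] imp[OF b(2,1) eq[symmetric]] by blast
qed

section \<open>The equivalences\<close>

lemma independent_seq_imp_IP:
  assumes a: "range a \<subseteq> A" and ind: "independent_seq T (\<lambda>i. R (a i)) n"
  shows "IP_in M \<phi> xs ys A"
proof -
  have "ip_witness M \<phi> xs ys UNIV (\<lambda>k. a (n k))"
    unfolding ip_witness_def
  proof (intro allI impI, elim conjE)
    fix I J :: "nat set"
    assume IJ: "finite I" "finite J" "I \<inter> J = {}"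
    define m where "m = Suc (Max (insert 0 (I \<union> J)))"
    have m: "k < m" if "k \<in> I \<union> J" for k
      using IJ(1,2) that by (auto simp: m_def less_Suc_eq_le intro: Max_ge)
    let ?bs = "map (\<lambda>k. k \<in> I) [0..<m]"
    have "\<exists>b\<in>T. map (\<lambda>k. R (a (n k)) b) [0..<m] = ?bs"
      using ind unfolding independent_seq_def by (metis length_map length_upt minus_nat.diff_0)
    then obtain b where b: "b \<in> T" "map (\<lambda>k. R (a (n k)) b) [0..<m] = ?bs"
      by blast
    have pat: "R (a (n k)) b \<longleftrightarrow> k \<in> I" if "k < m" for k
      using b(2) that by simp
    let ?F = "(\<lambda>k. a (n k)) ` (I \<union> J)"
    have F: "finite ?F" "?F \<subseteq> tuples M (length xs)"
      using IJ a A by auto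
    obtain b' where b': "b' \<in> TM" "\<forall>c\<in>?F. R c b' = R c b"
      using pattern_in_M[OF F b(1)] by blast
    have "holds M \<phi> xs ys (a (n k)) b' \<longleftrightarrow> k \<in> I" if k: "k \<in> I \<union> J" for k
    proof -
      have "holds M \<phi> xs ys (a (n k)) b' = R (a (n k)) b'"
        using k F(2) by (intro holds_M_iff b') blast
      also have "\<dots> = R (a (n k)) b"
        using b'(2) k by blast
      also have "\<dots> \<longleftrightarrow> k \<in> I"
        by (rule pat[OF m[OF k]])
      finally show ?thesis .
    qed
    then show "\<exists>b\<in>TM. (\<forall>i\<in>I. holds M \<phi> xs ys (a (n i)) b) \<and> (\<forall>j\<in>J. \<not> holds M \<phi> xs ys (a (n j)) b)"
      using b'(1) IJ(3) by (intro bexI[of _ b']) auto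
  qed
  moreover have "range (\<lambda>k. a (n k)) \<subseteq> A"
    using a by blast
  ultimately show ?thesis
    unfolding IP_in_def by blast
qed

lemma NIP_limit_sets:
  fixes a :: "'i::countable \<Rightarrow> 'm list"
  assumes "NIP_in M \<phi> xs ys A" and "range a \<subseteq> A" and U: "is_ultrafilter UNIV UNIV U"
  shows "\<exists>X :: nat \<Rightarrow> 'i set. (\<forall>k. X k \<in> U) \<and> (\<forall>b\<in>T. \<exists>k. \<forall>i\<in>X k. R (a i) b = ({i. R (a i) b} \<in> U))"
proof (rule settled_imp_limit_sets[OF U, of "\<lambda>i. R (a i)"], rule ccontr)
  assume "\<not> settled U (\<lambda>i. R (a i)) T"
  from unsettled_imp_independent[OF U this] show False
    using independent_seq_imp_IP assms(1,2) by (auto simp: NIP_in_def)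
qed

text \<open>Finite patterns are part of the definition of IP; saturation takes care of infinite ones. A pattern on
indices is a pattern on tuples because the terms of an IP-witness are distinct.\<close>

lemma IP_all_patterns:
  assumes a: "range a \<subseteq> A" and ip: "ip_witness M \<phi> xs ys (UNIV :: 'i set) a"
  shows "\<exists>b\<in>T. \<forall>i. R (a i) b \<longleftrightarrow> i \<in> S"
proof -
  have fin: "\<exists>b\<in>TM. (\<forall>i\<in>I. R (a i) b) \<and> (\<forall>j\<in>J. \<not> R (a j) b)"
    if IJ: "finite I" "finite J" "I \<inter> J = {}" for I J
  proof -
    have "\<exists>b\<in>TM. (\<forall>i\<in>I. holds M \<phi> xs ys (a i) b) \<and> (\<forall>j\<in>J. \<not> holds M \<phi> xs ys (a j) b)"
      using ip IJ unfolding ip_witness_def by blast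
    then obtain b where b: "b \<in> TM" "\<forall>i\<in>I. holds M \<phi> xs ys (a i) b" "\<forall>j\<in>J. \<not> holds M \<phi> xs ys (a j) b"
      by blast
    have "holds M \<phi> xs ys (a i) b = R (a i) b" for i
      using a A by (intro holds_M_iff b(1)) auto
    then show ?thesis
      using b by auto
  qed
  have inj: "inj a"
  proof (rule injI, rule ccontr)
    fix i j assume "a i = a j" "i \<noteq> j"
    then show False
      using fin[of "{i}" "{j}"] by auto
  qed
  have "\<exists>b\<in>T. \<forall>c\<in>range a. R c b \<longleftrightarrow> c \<in> a ` S"
  proof (rule pattern_realized)
    show "range a \<subseteq> tuples M (length xs)"
      using a A by blast
    fix F assume F: "finite F" "F \<subseteq> range a"
    obtain I where I: "finite I" "F = a ` I"
      using finite_subset_image[OF F] by blast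
    obtain b where b: "b \<in> TM" "\<forall>i\<in>I \<inter> S. R (a i) b" "\<forall>j\<in>I - S. \<not> R (a j) b"
      using fin[of "I \<inter> S" "I - S"] I(1) by blast
    have "\<forall>c\<in>F. R c b \<longleftrightarrow> c \<in> a ` S"
      using b(2,3) I(2) by (auto simp: inj_image_mem_iff[OF inj])
    then show "\<exists>b\<in>T. \<forall>c\<in>F. R c b \<longleftrightarrow> c \<in> a ` S"
      using b(1) TM_subset by blast
  qed
  then show ?thesis
    by (simp add: inj_image_mem_iff[OF inj])
qed

lemma NIP_imp_convergent_subseq:
  assumes nip: "NIP_in M \<phi> xs ys A" and a: "range a \<subseteq> A"
  shows "\<exists>j :: nat \<Rightarrow> nat. strict_mono j \<and>
    (\<forall>b\<in>T. \<exists>t. eventual_truth_value (\<lambda>i. R (a (j i)) b) t)"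
proof -
  obtain U :: "nat set set" where U: "is_ultrafilter UNIV UNIV U" and free: "\<And>k. {k..} \<in> U"
    using free_ultrafilter_exists by blast
  obtain X :: "nat \<Rightarrow> nat set" where X: "\<And>k. X k \<in> U"
    and lim: "\<And>b. b \<in> T \<Longrightarrow> \<exists>k. \<forall>i\<in>X k. R (a i) b = ({i. R (a i) b} \<in> U)"
    using NIP_limit_sets[OF nip a U] by blast
  have ex: "\<exists>i. i \<in> (\<Inter>k\<le>m. X k) \<and> n \<le> i" for m n
  proof -
    have "(\<Inter>k\<le>m. X k) \<inter> {n..} \<in> U"
      using X by (intro ultrafilter_Int[OF U] ultrafilter_finite_INT[OF U] free) auto
    then have "(\<Inter>k\<le>m. X k) \<inter> {n..} \<noteq> {}"
      by (rule ultrafilter_nonempty[OF U])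
    then show ?thesis
      by auto
  qed
  have "\<exists>j. \<forall>m. j m \<in> (\<Inter>k\<le>m. X k) \<and> j m < j (Suc m)"
  proof (rule dependent_nat_choice[where P = "\<lambda>m i. i \<in> (\<Inter>k\<le>m. X k)" and Q = "\<lambda>_ i i'. i < i'"])
    show "\<exists>i. i \<in> (\<Inter>k\<le>0. X k)"
      using ex[of 0 0] by blast
    show "\<exists>i'. i' \<in> (\<Inter>k\<le>Suc m. X k) \<and> i < i'" for i m
      using ex[of "Suc m" "Suc i"] by (auto simp: Suc_le_eq)
  qed
  then obtain j where j: "\<And>m. j m \<in> (\<Inter>k\<le>m. X k)" and mono: "\<And>m. j m < j (Suc m)"
    by blast
  have "\<exists>t. eventual_truth_value (\<lambda>i. R (a (j i)) b) t" if "b \<in> T" for b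
    using limit_sets_imp_convergent[where R = "\<lambda>i. R (a i)", OF lim j that] by blast
  then show ?thesis
    using mono by (intro exI[of _ j]) (simp add: strict_mono_Suc_iff)
qed

text \<open>Some parameter realizes the pattern that is true exactly at every other term of the subsequence.\<close>

lemma IP_imp_divergent:
  assumes a: "range a \<subseteq> A" and ip: "ip_witness M \<phi> xs ys (UNIV :: nat set) a" and j: "strict_mono j"
  shows "\<exists>b\<in>T. \<forall>t. \<not> eventual_truth_value (\<lambda>i. R (a (j i)) b) t"
proof -
  obtain b where b: "b \<in> T" "\<forall>i. R (a i) b \<longleftrightarrow> i \<in> j ` {i. even i}"
    using IP_all_patterns[OF a ip, of "j ` {i. even i}"] by blast
  have val: "R (a (j i)) b \<longleftrightarrow> even i" for i
    using b(2) inj_image_mem_iff[OF strict_mono_imp_inj_on[OF j]] by simp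
  have "\<not> eventual_truth_value (\<lambda>i. R (a (j i)) b) t" for t
  proof
    assume "eventual_truth_value (\<lambda>i. R (a (j i)) b) t"
    then obtain m :: nat where m: "\<And>i. m \<le> i \<Longrightarrow> even i = t"
      unfolding eventual_truth_value_def eventually_sequentially val by blast
    show False
      using m[of m] m[of "Suc m"] by simp
  qed
  then show ?thesis
    using b(1) by blast
qed

lemma fin_sat_types_empty: "A = {} \<Longrightarrow> fs_types = {}"
  using is_ultrafilter_Omega[OF fin_sat_type_ultrafilter] by (auto simp: fin_sat_types_def)

definition limit_of_seq :: "'m list set set \<Rightarrow> (nat \<Rightarrow> 'm list) \<Rightarrow> bool" where
  "limit_of_seq p a \<longleftrightarrow> range a \<subseteq> A \<and> (\<forall>b\<in>T. eventual_truth_value (\<lambda>i. R (a i) b) (phi_in p b))"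

lemma countable_enum:
  assumes "countable A" and "p \<in> fs_types"
  obtains a :: "nat \<Rightarrow> 'm list" where "range a = A"
proof -
  have "A \<noteq> {}"
    using fin_sat_types_empty assms(2) by blast
  then show ?thesis
    using that range_from_nat_into[OF _ assms(1)] by blast
qed

lemma NIP_type_limit_sets:
  assumes nip: "NIP_in M \<phi> xs ys A" and a: "range a = A" and p: "p \<in> fs_types"
  shows "\<exists>U X. is_ultrafilter UNIV UNIV U \<and> (\<forall>k. X k \<in> U) \<and>
    (\<forall>b\<in>T. phi_in p b \<longleftrightarrow> {i. R (a i) b} \<in> U) \<and>
    (\<forall>b\<in>T. \<exists>k::nat. \<forall>i::nat\<in>X k. R (a i) b = phi_in p b)"
proof -
  obtain U where U: "is_ultrafilter UNIV UNIV U" and p_U: "\<And>b. b \<in> T \<Longrightarrow> phi_in p b \<longleftrightarrow> {i. R (a i) b} \<in> U"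
    using fin_sat_type_ultrafilter_on_index[OF p a] by blast
  obtain X :: "nat \<Rightarrow> nat set" where X: "\<And>k. X k \<in> U"
    and lim: "\<And>b. b \<in> T \<Longrightarrow> \<exists>k. \<forall>i\<in>X k. R (a i) b = ({i. R (a i) b} \<in> U)"
    using NIP_limit_sets[OF nip _ U, of a] a by blast
  show ?thesis
    by (rule exI[of _ U], rule exI[of _ X]) (use U X p_U lim in simp)
qed

lemma NIP_imp_limit_of_seq:
  assumes nip: "NIP_in M \<phi> xs ys A" and A: "countable A" and p: "p \<in> fs_types"
  shows "\<exists>s. limit_of_seq p s"
proof -
  obtain a :: "nat \<Rightarrow> 'm list" where a: "range a = A"
    using countable_enum[OF A p] .
  obtain U X where U: "is_ultrafilter UNIV UNIV U" and X: "\<And>k. X k \<in> U"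
    and lim: "\<And>b. b \<in> T \<Longrightarrow> \<exists>k::nat. \<forall>i::nat\<in>X k. R (a i) b = phi_in p b"
    using NIP_type_limit_sets[OF nip a p] by blast
  have "\<exists>i. i \<in> (\<Inter>k\<le>m. X k)" for m
  proof -
    have "(\<Inter>k\<le>m. X k) \<in> U"
      using X by (intro ultrafilter_finite_INT[OF U]) auto
    then have "(\<Inter>k\<le>m. X k) \<noteq> {}"
      by (rule ultrafilter_nonempty[OF U])
    then show ?thesis
      by blast
  qed
  then obtain j where j: "\<And>m. j m \<in> (\<Inter>k\<le>m. X k)"
    by metis
  have "limit_of_seq p (\<lambda>m. a (j m))"
    unfolding limit_of_seq_def
  proof (intro conjI ballI)
    show "range (\<lambda>m. a (j m)) \<subseteq> A"
      using a by blast
    show "eventual_truth_value (\<lambda>i. R (a (j i)) b) (phi_in p b)" if "b \<in> T" for b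
      using limit_sets_imp_convergent[where R = "\<lambda>i. R (a i)" and t = "phi_in p", OF lim j that] .
  qed
  then show ?thesis
    by blast
qed

lemma limit_of_seq_unique:
  assumes "p \<in> fs_types" "p' \<in> fs_types" "limit_of_seq p s" "limit_of_seq p' s"
  shows "p = p'"
  using assms(1,2)
proof (rule fin_sat_type_eqI)
  fix b assume b: "b \<in> T"
  have "eventual_truth_value (\<lambda>i. R (s i) b) (phi_in p b)"
    using assms(3) b by (simp add: limit_of_seq_def)
  moreover have "eventual_truth_value (\<lambda>i. R (s i) b) (phi_in p' b)"
    using assms(4) b by (simp add: limit_of_seq_def)
  ultimately show "phi_in p b = phi_in p' b"
    by (rule eventual_truth_value_unique)
qed

text \<open>A type is determined by a sequence from \<open>A\<close> that converges to it, and a countable \<open>A\<close> has only continuum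
many sequences.\<close>

lemma card_of_limits:
  assumes A: "countable A" and lim: "\<And>p. p \<in> fs_types \<Longrightarrow> \<exists>s. limit_of_seq p s"
  shows "|fs_types| \<le>o |UNIV :: nat set set|"
proof -
  define s where "s p = (SOME s. limit_of_seq p s)" for p
  have s: "limit_of_seq p (s p)" if "p \<in> fs_types" for p
    unfolding s_def by (rule someI_ex[OF lim[OF that]])
  have range_s: "s p i \<in> A" if "p \<in> fs_types" for p i
    using s[OF that] by (auto simp: limit_of_seq_def)
  define code where "code p = (\<lambda>i. to_nat_on A (s p i))" for p
  have "inj_on code fs_types"
  proof (rule inj_onI)
    fix p p' assume p: "p \<in> fs_types" "p' \<in> fs_types" and eq: "code p = code p'"
    have "s p i = s p' i" for i
      using fun_cong[OF eq, of i] range_s[OF p(1)] range_s[OF p(2)] A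
      by (simp add: code_def)
    then have "s p = s p'"
      by blast
    then show "p = p'"
      using limit_of_seq_unique[OF p s[OF p(1)]] s[OF p(2)] by simp
  qed
  then have "|fs_types| \<le>o |UNIV :: (nat \<Rightarrow> nat) set|"
    by (intro card_of_ordLeqI) auto
  also have "|UNIV :: (nat \<Rightarrow> nat) set| \<le>o |UNIV :: nat set set|"
    by (rule card_of_countable_fun)
  finally show ?thesis .
qed

text \<open>As \<open>UNIV :: nat set set set\<close> is the set of all elements of type \<open>nat set set\<close>, the cardinal on the left
is \<open>2\<close> to the \<open>2\<^sup>\<omega>\<close>. For each \<open>\<T>\<close> there is an ultrafilter on the indices that contains, from the
independent family, exactly the sets with index in \<open>\<T>\<close>; the parameters that realize the sets of the
family recover \<open>\<T>\<close> from the corresponding type.\<close>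

lemma IP_many_types:
  assumes "IP_in M \<phi> xs ys A"
  shows "|UNIV :: nat set set set| \<le>o |fs_types|"
proof -
  from assms obtain a :: "nat \<Rightarrow> 'm list" where "range a \<subseteq> A \<and> ip_witness M \<phi> xs ys UNIV a"
    unfolding IP_in_def by (rule exE)
  then have a: "range a \<subseteq> A" and ip: "ip_witness M \<phi> xs ys UNIV a"
    by simp_all
  define a' :: "nat list \<times> nat list list \<Rightarrow> 'm list" where "a' i = a (to_nat i)" for i
  have a': "range a' \<subseteq> A"
    using a by (auto simp: a'_def)
  have "\<exists>b\<in>T. \<forall>i. R (a' i) b \<longleftrightarrow> i \<in> filter_code S" for S
  proof -
    obtain b where b: "b \<in> T" "\<forall>i. R (a i) b \<longleftrightarrow> i \<in> to_nat ` filter_code S"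
      using IP_all_patterns[OF a ip] by blast
    have "R (a' i) b \<longleftrightarrow> i \<in> filter_code S" for i
      using b(2) by (simp add: a'_def inj_image_mem_iff)
    then show ?thesis
      using b(1) by blast
  qed
  then have "\<forall>S. \<exists>b. b \<in> T \<and> {i. R (a' i) b} = filter_code S"
    by blast
  from choice[OF this] obtain b where b: "\<And>S. b S \<in> T" "\<And>S. {i. R (a' i) (b S)} = filter_code S"
    by blast
  have "\<forall>\<T>. \<exists>p. p \<in> fs_types \<and> (\<forall>S. phi_in p (b S) \<longleftrightarrow> S \<in> \<T>)"
  proof
    fix \<T>
    obtain U where U: "is_ultrafilter UNIV UNIV U" "\<And>S. filter_code S \<in> U \<longleftrightarrow> S \<in> \<T>"
      using ultrafilter_prescribed by blast
    obtain p where p: "p \<in> fs_types" "\<forall>b\<in>T. phi_in p b \<longleftrightarrow> {i. R (a' i) b} \<in> U"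
      using fin_sat_type_of_ultrafilter[OF U(1) a'] by blast
    have "phi_in p (b S) \<longleftrightarrow> S \<in> \<T>" for S
      using p(2) b U(2) by simp
    then show "\<exists>p. p \<in> fs_types \<and> (\<forall>S. phi_in p (b S) \<longleftrightarrow> S \<in> \<T>)"
      using p(1) by blast
  qed
  from choice[OF this] obtain p where p: "\<And>\<T>. p \<T> \<in> fs_types"
    and val: "\<And>\<T> S. phi_in (p \<T>) (b S) \<longleftrightarrow> S \<in> \<T>"
    by blast
  have "inj p"
  proof (rule injI)
    fix \<T> \<T>' assume "p \<T> = p \<T>'"
    then have "S \<in> \<T> \<longleftrightarrow> S \<in> \<T>'" for S
      using val[of \<T> S] val[of \<T>' S] by simp
    then show "\<T> = \<T>'"
      by blast
  qed
  then show ?thesis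
    using p by (intro card_of_ordLeqI) auto
qed

text \<open>The set whose Borel measurability is asserted by \<open>borel_definable\<close>.\<close>

definition definition_of :: "'m list set set \<Rightarrow> 'm list set set set" where
  "definition_of p = {q \<in> S_opp M \<phi> xs ys A. \<exists>b\<in>T. tp_opp M N \<phi> xs ys A b = q \<and> phi_in p b}"

lemma tp_opp_in_definition_of_iff:
  assumes p: "p \<in> fs_types" and b: "b \<in> T"
  shows "tp_opp M N \<phi> xs ys A b \<in> definition_of p \<longleftrightarrow> phi_in p b"
proof
  assume "tp_opp M N \<phi> xs ys A b \<in> definition_of p"
  then obtain b' where b': "b' \<in> T" "tp_opp M N \<phi> xs ys A b' = tp_opp M N \<phi> xs ys A b" "phi_in p b'"
    unfolding definition_of_def by blast
  have "R a b' = R a b" if "a \<in> A" for a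
    using inst_in_tp_opp_iff[OF b'(1) that] inst_in_tp_opp_iff[OF b that] b'(2) by simp
  then have "phi_in p b' = phi_in p b"
    by (rule phi_in_invariant[OF p b'(1) b])
  then show "phi_in p b"
    using b'(3) by simp
next
  assume "phi_in p b"
  then show "tp_opp M N \<phi> xs ys A b \<in> definition_of p"
    unfolding definition_of_def using tp_opp_in_S_opp[OF b] b by blast
qed

lemma sigma_algebra_borel_sets_of: "sigma_algebra (topspace X) (borel_sets_of X)"
  unfolding borel_sets_of_def by (rule sigma_algebra_sigma_sets) (auto dest: openin_subset)

text \<open>With the limit sets \<open>X k\<close> of the ultrafilter of \<open>p\<close>, the definition of \<open>p\<close> is \<open>(\<Union>k. \<Inter>i\<in>X k. C i)\<close>
where \<open>C i\<close> is the clopen set given by the formula \<open>\<phi>(a i, y)\<close>.\<close>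

lemma NIP_imp_borel_definable:
  assumes nip: "NIP_in M \<phi> xs ys A" and A: "countable A" and p: "p \<in> fs_types"
  shows "definition_of p \<in> borel_sets_of (types_topology M \<phi> ys xs A)"
proof -
  let ?T = "types_topology M \<phi> ys xs A"
  interpret S: sigma_algebra "topspace ?T" "borel_sets_of ?T"
    by (rule sigma_algebra_borel_sets_of)
  obtain a :: "nat \<Rightarrow> 'm list" where a: "range a = A"
    using countable_enum[OF A p] .
  then have aA: "a i \<in> A" for i
    by blast
  obtain U X where U: "is_ultrafilter UNIV UNIV U" and X: "\<And>k. X k \<in> U"
    and p_U: "\<And>b. b \<in> T \<Longrightarrow> phi_in p b \<longleftrightarrow> {i. R (a i) b} \<in> U"
    and lim: "\<And>b. b \<in> T \<Longrightarrow> \<exists>k::nat. \<forall>i::nat\<in>X k. R (a i) b = phi_in p b"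
    using NIP_type_limit_sets[OF nip a p] by blast
  define C where "C i = {q \<in> S_opp M \<phi> xs ys A. inst M \<phi> ys xs (a i) \<in> q}" for i
  have C: "C i \<in> borel_sets_of ?T" for i
  proof -
    have "openin ?T (C i)"
      unfolding types_topology_def stone_topology_def
      by (rule topology_generated_by_Basis)
        (auto simp: C_def S_opp_def types_def intro: inst_in_algebra[OF aA])
    then show ?thesis
      unfolding borel_sets_of_def by (intro sigma_sets.Basic) simp
  qed
  have tp_C: "tp_opp M N \<phi> xs ys A b \<in> C i \<longleftrightarrow> R (a i) b" if "b \<in> T" for b i
    using tp_opp_in_S_opp[OF that] inst_in_tp_opp_iff[OF that aA] by (simp add: C_def)
  have phi_iff: "phi_in p b \<longleftrightarrow> (\<exists>k. \<forall>i\<in>X k. R (a i) b)" if b: "b \<in> T" for b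
  proof
    assume "phi_in p b"
    then show "\<exists>k. \<forall>i\<in>X k. R (a i) b"
      using lim[OF b] by simp
  next
    assume "\<exists>k. \<forall>i\<in>X k. R (a i) b"
    then obtain k where "X k \<subseteq> {i. R (a i) b}"
      by blast
    then show "phi_in p b"
      unfolding p_U[OF b] by (rule ultrafilter_mono[OF U X])
  qed
  have iff: "q \<in> definition_of p \<longleftrightarrow> (\<exists>k. \<forall>i\<in>X k. q \<in> C i)" if q: "q \<in> S_opp M \<phi> xs ys A" for q
  proof -
    obtain b where b: "b \<in> T" "tp_opp M N \<phi> xs ys A b = q"
      using S_opp_realized[OF q] by blast
    show ?thesis
      using tp_opp_in_definition_of_iff[OF p b(1)] phi_iff[OF b(1)] tp_C[OF b(1)] b(2) by simp
  qed
  have Xne: "X k \<noteq> {}" for k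
    using X by (rule ultrafilter_nonempty[OF U])
  have "definition_of p = (\<Union>k. \<Inter>i\<in>X k. C i)"
  proof (rule set_eqI)
    fix q
    show "q \<in> definition_of p \<longleftrightarrow> q \<in> (\<Union>k. \<Inter>i\<in>X k. C i)"
    proof (cases "q \<in> S_opp M \<phi> xs ys A")
      case True
      then show ?thesis
        using iff by simp
    next
      case False
      then have "q \<notin> definition_of p" "\<And>i. q \<notin> C i"
        by (simp_all add: definition_of_def C_def)
      then show ?thesis
        using Xne by auto
    qed
  qed
  also have "\<dots> \<in> borel_sets_of ?T"
  proof (rule S.countable_UN)
    have "(\<Inter>i\<in>X k. C i) \<in> borel_sets_of ?T" for k
      using Xne C by (intro S.countable_INT') auto
    then show "range (\<lambda>k. \<Inter>i\<in>X k. C i) \<subseteq> borel_sets_of ?T"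
      by blast
  qed
  finally show ?thesis .
qed

text \<open>A type is determined by its definition over \<open>A\<close>, and the Stone space of the countable algebra generated
over \<open>A\<close> has at most continuum many Borel sets.\<close>

lemma card_of_borel_definable:
  assumes A: "countable A"
    and borel: "\<And>p. p \<in> fs_types \<Longrightarrow> definition_of p \<in> borel_sets_of (types_topology M \<phi> ys xs A)"
  shows "|fs_types| \<le>o |UNIV :: nat set set|"
proof -
  let ?T = "types_topology M \<phi> ys xs A"
  have "inj_on definition_of fs_types"
  proof (rule inj_onI)
    fix p p' assume p: "p \<in> fs_types" "p' \<in> fs_types" and eq: "definition_of p = definition_of p'"
    show "p = p'"
      using p
    proof (rule fin_sat_type_eqI)
      fix b assume b: "b \<in> T"
      show "phi_in p b = phi_in p' b"
        using tp_opp_in_definition_of_iff[OF p(1) b] tp_opp_in_definition_of_iff[OF p(2) b] eq by simp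
    qed
  qed
  then have "|fs_types| \<le>o |borel_sets_of ?T|"
    using borel by (intro card_of_ordLeqI) auto
  also have "|borel_sets_of ?T| \<le>o |UNIV :: nat set set|"
  proof -
    have "countable (inst_algebra M \<phi> ys xs A)"
      unfolding inst_algebra_def using A by (intro countable_algebra_hull[OF inst_image_subset]) simp
    then show ?thesis
      unfolding types_topology_def by (rule card_of_borel_sets_stone_topology[OF algebra_inst])
  qed
  finally show ?thesis .
qed

lemma few_types_imp_NIP:
  assumes "|fs_types| <o |UNIV :: nat set set set|"
  shows "NIP_in M \<phi> xs ys A"
  unfolding NIP_in_def using IP_many_types not_ordLess_ordLeq[OF assms] by blast

lemma le_continuum_imp_less:
  assumes "|fs_types| \<le>o |UNIV :: nat set set|"
  shows "|fs_types| <o |UNIV :: nat set set set|"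
proof -
  have "|UNIV :: nat set set| <o |Pow (UNIV :: nat set set)|"
    by (rule card_of_Pow)
  then show ?thesis
    using ordLeq_ordLess_trans[OF assms] by simp
qed

lemma NIP_iff_convergent_subseq:
  "NIP_in M \<phi> xs ys A \<longleftrightarrow>
    (\<forall>a :: nat \<Rightarrow> 'm list. range a \<subseteq> A \<longrightarrow>
       (\<exists>j :: nat \<Rightarrow> nat. strict_mono j \<and>
          (\<forall>b\<in>T. \<exists>t. eventual_truth_value (\<lambda>i. R (a (j i)) b) t)))"
proof
  assume "NIP_in M \<phi> xs ys A"
  then show "\<forall>a :: nat \<Rightarrow> 'm list. range a \<subseteq> A \<longrightarrow>
       (\<exists>j :: nat \<Rightarrow> nat. strict_mono j \<and>
          (\<forall>b\<in>T. \<exists>t. eventual_truth_value (\<lambda>i. R (a (j i)) b) t))"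
    using NIP_imp_convergent_subseq by blast
next
  assume conv: "\<forall>a :: nat \<Rightarrow> 'm list. range a \<subseteq> A \<longrightarrow>
       (\<exists>j :: nat \<Rightarrow> nat. strict_mono j \<and>
          (\<forall>b\<in>T. \<exists>t. eventual_truth_value (\<lambda>i. R (a (j i)) b) t))"
  show "NIP_in M \<phi> xs ys A"
    unfolding NIP_in_def
  proof
    assume "IP_in M \<phi> xs ys A"
    then obtain a :: "nat \<Rightarrow> 'm list" where a: "range a \<subseteq> A" and ip: "ip_witness M \<phi> xs ys UNIV a"
      unfolding IP_in_def by blast
    from conv a obtain j where j: "strict_mono j"
      and b: "\<forall>b\<in>T. \<exists>t. eventual_truth_value (\<lambda>i. R (a (j i)) b) t"
      by blast
    from IP_imp_divergent[OF a ip j] b show False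
      by blast
  qed
qed

lemma NIP_imp_card:
  "NIP_in M \<phi> xs ys A \<Longrightarrow> countable A \<Longrightarrow> |fs_types| \<le>o |UNIV :: nat set set|"
  by (rule card_of_limits) (simp_all add: NIP_imp_limit_of_seq)

lemma NIP_iff_borel_definable:
  assumes "countable A"
  shows "NIP_in M \<phi> xs ys A \<longleftrightarrow> (\<forall>p\<in>fs_types. borel_definable M N \<phi> xs ys A p)"
proof -
  have "borel_definable M N \<phi> xs ys A p \<longleftrightarrow> definition_of p \<in> borel_sets_of (types_topology M \<phi> ys xs A)"
    for p
    by (simp add: borel_definable_def definition_of_def)
  then show ?thesis
    using NIP_imp_borel_definable[OF _ assms]
      few_types_imp_NIP[OF le_continuum_imp_less[OF card_of_borel_definable[OF assms]]] by blast
qed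

lemma NIP_iff_limit_of_seq:
  assumes "countable A"
  shows "NIP_in M \<phi> xs ys A \<longleftrightarrow> (\<forall>p\<in>fs_types. \<exists>s. limit_of_seq p s)"
  using NIP_imp_limit_of_seq[OF _ assms] few_types_imp_NIP[OF le_continuum_imp_less[OF card_of_limits[OF assms]]]
  by blast

lemma NIP_iff_few_types:
  assumes "countable A"
  shows "NIP_in M \<phi> xs ys A \<longleftrightarrow> |fs_types| <o |UNIV :: nat set set set|"
  using few_types_imp_NIP le_continuum_imp_less[OF NIP_imp_card[OF _ assms]] by blast

end

theorem corollary2p2:
  fixes L :: "('f, 'r) lang"
    and M Mstar :: "('f, 'r, 'm) struc"
    and \<phi> :: "('f, 'r) fm"
    and xs ys :: "nat list"
    and A :: "'m list set"
  assumes "is_struc L M"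
    and "elem_ext L M Mstar"
    and "saturated L (cardSuc |univ M| ) Mstar"
    and "wf_fm L \<phi>"
    and "distinct (xs @ ys)"
    and "fv \<phi> \<subseteq> set (xs @ ys)"
    and "A \<subseteq> tuples M (length xs)"
  shows
    "(NIP_in M \<phi> xs ys A \<longleftrightarrow>
        (\<forall>a :: nat \<Rightarrow> 'm list. range a \<subseteq> A \<longrightarrow>
           (\<exists>j :: nat \<Rightarrow> nat. strict_mono j \<and>
              (\<forall>b \<in> tuples Mstar (length ys). \<exists>t.
                 eventual_truth_value (\<lambda>i. holds Mstar \<phi> xs ys (a (j i)) b) t)))) \<and>
     (countable A \<longrightarrow>
        (NIP_in M \<phi> xs ys A \<longleftrightarrow>
           (\<forall>p \<in> fin_sat_types Mstar \<phi> xs ys A. borel_definable M Mstar \<phi> xs ys A p)) \<and>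
        (NIP_in M \<phi> xs ys A \<longleftrightarrow>
           (\<forall>p \<in> fin_sat_types Mstar \<phi> xs ys A. \<exists>a :: nat \<Rightarrow> 'm list. range a \<subseteq> A \<and>
              (\<forall>b \<in> tuples Mstar (length ys).
                 eventual_truth_value (\<lambda>i. holds Mstar \<phi> xs ys (a i) b)
                   (phi_at Mstar \<phi> xs ys p b)))) \<and>
        (NIP_in M \<phi> xs ys A \<longleftrightarrow>
           |fin_sat_types Mstar \<phi> xs ys A| <o |UNIV :: nat set set set| ) \<and>
        ( |fin_sat_types Mstar \<phi> xs ys A| <o |UNIV :: nat set set set| \<longrightarrow>
           |fin_sat_types Mstar \<phi> xs ys A| \<le>o |UNIV :: nat set set| ))"
proof -
  interpret saturated_ext L M Mstar \<phi> xs ys A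
    using assms(2-7) by unfold_locales
  show ?thesis
  proof (intro conjI impI)
    show "NIP_in M \<phi> xs ys A \<longleftrightarrow>
        (\<forall>a :: nat \<Rightarrow> 'm list. range a \<subseteq> A \<longrightarrow>
           (\<exists>j :: nat \<Rightarrow> nat. strict_mono j \<and>
              (\<forall>b\<in>T. \<exists>t. eventual_truth_value (\<lambda>i. R (a (j i)) b) t)))"
      by (rule NIP_iff_convergent_subseq)
    assume A: "countable A"
    show "NIP_in M \<phi> xs ys A \<longleftrightarrow> (\<forall>p\<in>fs_types. borel_definable M Mstar \<phi> xs ys A p)"
      by (rule NIP_iff_borel_definable[OF A])
    show "NIP_in M \<phi> xs ys A \<longleftrightarrow> (\<forall>p\<in>fs_types. \<exists>a :: nat \<Rightarrow> 'm list. range a \<subseteq> A \<and>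
        (\<forall>b\<in>T. eventual_truth_value (\<lambda>i. R (a i) b) (phi_in p b)))"
      using NIP_iff_limit_of_seq[OF A] unfolding limit_of_seq_def .
    show "NIP_in M \<phi> xs ys A \<longleftrightarrow> |fs_types| <o |UNIV :: nat set set set|"
      by (rule NIP_iff_few_types[OF A])
    show "|fs_types| \<le>o |UNIV :: nat set set|" if "|fs_types| <o |UNIV :: nat set set set|"
      using few_types_imp_NIP[OF that] A by (rule NIP_imp_card)
  qed
qed

end
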